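(* For $A\in\mathcal{S}_e\subset\mathcal{S}$, put $\mathcal{M}_A:=\mathcal{S}_e\cap\mathcal{B}_\pi(A)$ and $\mathcal{Z}_A:=\{\exp(X):X\in\mathcal{M}_A\}$. Then the matrix exponential $\exp:\mathcal{M}_A\to\mathcal{Z}_A$ is a diffeomorphism that has a smooth inverse. Moreover, $\mathcal{B}_{\mathrm{dist}(A,\mathfrak{S})}(A)\subset\mathcal{M}_A$.
   Context: Let $n$ be a positive integer and $m=\lfloor n/2\rfloor$. $\mathbf{Skew}_n=\{A\in\mathbb{R}^{n\times n}:A+A^{T}=0\}$, $\mathcal{SO}_n=\{Q\in\mathbb{R}^{n\times n}:Q^{T}Q=I_n,\det Q=1\}$, and $\exp:\mathbf{Skew}_n\to\mathcal{SO}_n$ is the matrix exponential. $\|\cdot\|_2$ is the matrix 2-norm (spectral norm), $\mathcal{B}_\delta(A)=\{B\in\mathbf{Skew}_n:\|B-A\|_2<\delta\}$, and $\mathrm{dist}(A,\mathfrak{S})=\min_{B\in\mathfrak{S}}\|A-B\|_2$. Angles: every $A\in\mathbf{Skew}_n$ has a real Schur decomposition $A=R\Xi R^{T}$ with $R$ real orthogonal and $\Xi$ block diagonal with $2\times2$ diagonal blocks $\begin{bmatrix}0&-\theta_i\\ \theta_i&0\end{bmatrix}$, $\theta_i\in\mathbb{R}$, $i=1,\dots,m$, followed by a $1\times1$ block $0$ if $n=2m+1$. The vector $(\theta_1,\dots,\theta_m)$ is called a vector of angles of $A$; it is determined up to permutation and sign flips of its entries. The tangent conjugate locus $\mathfrak{S}\subset\mathbf{Skew}_n$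 is the set of $A\in\mathbf{Skew}_n$ at which the derivative of $\exp:\mathbf{Skew}_n\to\mathcal{SO}_n$ is rank-deficient; equivalently, the set of $A$ whose angles satisfy $\theta_i+\theta_j=2l\pi$ or $\theta_i-\theta_j=2l\pi$ for some $i\ne j$ and some integer $l\ne0$, or (when $n=2m+1$) $\theta_i=2l\pi$ for some $i$ and some integer $l\neq0$. It is a closed subset of $\mathbf{Skew}_n$; the set $\mathcal{S}=\mathbf{Skew}_n\setminus\mathfrak{S}$ is open in $\mathbf{Skew}_n$, and $\mathcal{S}_e$, $e\in\mathcal{E}$ ($\mathcal{E}$ a countable index set), denote its connected components, which are open, so that $\mathcal{S}=\bigcup_{e\in\mathcal{E}}\mathcal{S}_e$.
   Formalization: The last inclusion fails for n=3 (A=0: distance to the locus is 2π>π) and is undefined for n=2 (empty locus); it is proved as stated for all other n, and for every n with radius min(dist(A,𝔖),π) in place of dist(A,𝔖). *)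

theory Defs
  imports "HOL-Analysis.Analysis"
begin

text \<open>
  The dimension \<open>n \<ge> 1\<close> is \<open>CARD('n)\<close>, and \<open>n \<times> n\<close> matrices have type \<open>real^'n^'n\<close>.
\<close>

definition skew_matrices :: "(real^'n^'n) set" where
  "skew_matrices = {A. A + transpose A = 0}"

definition special_orthogonal :: "(real^'n^'n) set" where
  "special_orthogonal = {Q. transpose Q ** Q = mat 1 \<and> det Q = 1}"

text \<open>
  The class-based \<open>exp\<close> of the library is not available at this type, because
  \<open>(*)\<close> on \<open>real^'n^'n\<close> is not the matrix product.
\<close>

definition matrix_exp :: "real^'n^'n \<Rightarrow> real^'n^'n" where
  "matrix_exp A = (\<Sum>k. (1 / fact k) *\<^sub>R (((**) A ^^ k) (mat 1)))"

text \<open>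
  The 2-norm is the operator norm for the Euclidean norm; the library's \<open>norm\<close> on
  \<open>real^'n^'n\<close> is the Frobenius norm. Topological notions are the same for both.
\<close>

definition spectral_norm :: "real^'n^'n \<Rightarrow> real" where
  "spectral_norm A = onorm (\<lambda>x. A *v x)"

text \<open>Radii are extended reals, since the distance to an empty locus is \<open>\<infinity>\<close>.\<close>

definition skew_ball :: "real^'n^'n \<Rightarrow> ereal \<Rightarrow> (real^'n^'n) set" where
  "skew_ball A \<delta> = {B \<in> skew_matrices. ereal (spectral_norm (B - A)) < \<delta>}"

text \<open>
  The derivative at \<open>A\<close> of the exponential as a map from skew-symmetric matrices to
  the special orthogonal group is the restriction to the skew-symmetric matrices of its
  derivative on the space of all matrices. Rank-deficient means that its rank, the dimension
  of its image, is less than the common dimension of both manifolds.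
\<close>

definition tangent_conjugate_locus :: "(real^'n^'n) set" where
  "tangent_conjugate_locus =
     {A \<in> skew_matrices.
        dim (frechet_derivative matrix_exp (at A) ` skew_matrices)
          < dim (skew_matrices :: (real^'n^'n) set)}"

definition locus_dist :: "real^'n^'n \<Rightarrow> ereal" where
  "locus_dist A = (INF B\<in>tangent_conjugate_locus. ereal (spectral_norm (A - B)))"

text \<open>Intended for open \<open>U\<close>; \<open>Ck_on k U f\<close> says that \<open>f\<close> is of class \<open>C\<^sup>k\<close> on \<open>U\<close>.\<close>

primrec Ck_on :: "nat \<Rightarrow> 'a::euclidean_space set \<Rightarrow> ('a \<Rightarrow> 'b::euclidean_space) \<Rightarrow> bool" where
  "Ck_on 0 U f \<longleftrightarrow> continuous_on U f"
| "Ck_on (Suc k) U f \<longleftrightarrow>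
     (\<forall>x\<in>U. f differentiable (at x)) \<and>
     (\<forall>v. Ck_on k U (\<lambda>x. frechet_derivative f (at x) v))"

text \<open>
  Smoothness on an arbitrary subset of a Euclidean space means local extendability to smooth
  maps on open sets. On embedded submanifolds, such as open subsets of the
  skew-symmetric matrices or of the special orthogonal group, it is the usual smoothness.
\<close>

definition smooth_map_on :: "'a::euclidean_space set \<Rightarrow> ('a \<Rightarrow> 'b::euclidean_space) \<Rightarrow> bool" where
  "smooth_map_on S f \<longleftrightarrow>
     (\<forall>x\<in>S. \<exists>U g. open U \<and> x \<in> U \<and> (\<forall>k. Ck_on k U g) \<and> (\<forall>y\<in>U \<inter> S. g y = f y))"

definition diffeomorphism ::
    "'a::euclidean_space set \<Rightarrow> 'b::euclidean_space set \<Rightarrow> ('a \<Rightarrow> 'b) \<Rightarrow> bool" where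
  "diffeomorphism S T f \<longleftrightarrow>
     bij_betw f S T \<and> smooth_map_on S f \<and> smooth_map_on T (inv_into S f)"

end

theory Submission
  imports Defs
begin

text \<open>
  Conjugation equivariance of the exponential gives \<open>D exp\<^sub>X([X, Y]) = [exp X, Y]\<close>. Hence if \<open>X\<close>
  is not conjugate and \<open>exp X = exp Y\<close>, then \<open>[exp X, Y] = 0\<close> forces \<open>[X, Y] = 0\<close>, so that
  \<open>exp (Y - X) = 1\<close>; the eigenvalues of \<open>Y - X\<close> lie in \<open>2\<pi>i\<int>\<close>, and \<open>Y - X\<close> has norm below \<open>2\<pi>\<close>
  when \<open>X\<close> and \<open>Y\<close> are in the ball, so \<open>X = Y\<close>. No description of the locus by angles is needed.

  The exponential is smooth because its iterated directional derivatives form a family of power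
  series that is closed under differentiation. Its local inverses come from the inverse function
  theorem on the space of all matrices, applied to \<open>W \<mapsto> exp (K) (1 + S)\<close> with \<open>K\<close> and \<open>S\<close> the
  skew-symmetric and symmetric parts of \<open>W\<close>: an orthogonal value close to the group forces \<open>S = 0\<close>.

  In dimension at least 4 there are two orthogonal invariant planes. Changing both angles by the same
  amount of at most \<open>\<pi>\<close> makes their sum a nonzero multiple of \<open>2\<pi>\<close>, hence the locus is within
  distance \<open>\<pi>\<close>, which is why the ball of radius \<open>locus_dist A\<close> lies in the ball of radius \<open>\<pi>\<close>.
\<close>

section \<open>Calculus of maps of class \<open>C\<^sup>k\<close>\<close>

lemma Ck_on_imp_continuous_on: "Ck_on k U f \<Longrightarrow> continuous_on U f"
  by (cases k) (auto intro!: continuous_at_imp_continuous_on differentiable_imp_continuous_within)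

lemma Ck_on_SucD: "Ck_on (Suc k) U f \<Longrightarrow> Ck_on k U f"
proof (induction k arbitrary: f)
  case 0
  then show ?case using Ck_on_imp_continuous_on[of "Suc 0" U f] by simp
next
  case (Suc k)
  from Suc.prems have "f differentiable (at x)" if "x \<in> U" for x
    using that by simp
  moreover have "Ck_on k U (\<lambda>x. frechet_derivative f (at x) v)" for v
    using Suc.prems by (intro Suc.IH) simp
  ultimately show ?case by simp
qed

text \<open>At an interior point the derivative depends only on the values near that point, so on an
  open set equality of two functions passes to all iterated derivatives.\<close>

lemma Ck_on_cong:
  assumes "open U" "\<And>x. x \<in> U \<Longrightarrow> f x = g x"
  shows "Ck_on k U f = Ck_on k U g"
  using assms(2)
proof (induction k arbitrary: f g)
  case 0
  then show ?case by (auto cong: continuous_on_cong)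
next
  case (Suc k)
  have imp: "(f' has_derivative D) (at x)"
    if "(g' has_derivative D) (at x)" "\<And>y. y \<in> U \<Longrightarrow> f' y = g' y" "x \<in> U" for f' g' D x
    by (rule has_derivative_transform_within_open[OF that(1) \<open>open U\<close>]) (use that in auto)
  have iff: "(f has_derivative D) (at x) \<longleftrightarrow> (g has_derivative D) (at x)" if "x \<in> U" for D x
    using imp[of g D x f] imp[of f D x g] Suc.prems that by auto
  have "frechet_derivative f (at x) = frechet_derivative g (at x)" if "x \<in> U" for x
    unfolding frechet_derivative_def using iff[OF that] by simp
  then have "Ck_on k U (\<lambda>x. frechet_derivative f (at x) v)
      = Ck_on k U (\<lambda>x. frechet_derivative g (at x) v)" for v
    by (intro Suc.IH) simp
  then show ?case
    using iff by (auto simp: differentiable_def)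
qed

lemma Ck_on_SucI:
  assumes "open U" and D: "\<And>x. x \<in> U \<Longrightarrow> (f has_derivative f' x) (at x)"
    and "\<And>v. Ck_on k U (\<lambda>x. f' x v)"
  shows "Ck_on (Suc k) U f"
proof -
  have "frechet_derivative f (at x) = f' x" if "x \<in> U" for x
    using frechet_derivative_at[OF D[OF that]] by simp
  then have "Ck_on k U (\<lambda>x. frechet_derivative f (at x) v)" for v
    using assms(3)[of v] Ck_on_cong[OF \<open>open U\<close>, of "\<lambda>x. frechet_derivative f (at x) v" "\<lambda>x. f' x v"]
    by simp
  then show ?thesis
    using D by (auto simp: differentiable_def)
qed

lemma Ck_on_Suc_has_derivative:
  "Ck_on (Suc k) U f \<Longrightarrow> x \<in> U \<Longrightarrow> (f has_derivative frechet_derivative f (at x)) (at x)"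
  by (simp add: frechet_derivative_works)

lemma Ck_on_subset:
  assumes "V \<subseteq> U" shows "Ck_on k U f \<Longrightarrow> Ck_on k V f"
  by (induction k arbitrary: f) (use assms in \<open>auto intro: continuous_on_subset\<close>)

lemma Ck_on_const: "open U \<Longrightarrow> Ck_on k U (\<lambda>x. c)"
  by (induction k arbitrary: c) (auto intro: Ck_on_SucI[where f' = "\<lambda>_ _. 0"] simp del: Ck_on.simps(2))

lemma Ck_on_bounded_linear:
  assumes "open U" "bounded_linear L"
  shows "Ck_on k U L"
proof (cases k)
  case 0
  then show ?thesis using assms by (simp add: linear_continuous_on)
next
  case (Suc j)
  show ?thesis unfolding Suc
    by (rule Ck_on_SucI[where f' = "\<lambda>_. L"])
      (use assms in \<open>auto intro: Ck_on_const bounded_linear_imp_has_derivative\<close>)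
qed

lemma Ck_on_add:
  assumes "open U"
  shows "Ck_on k U f \<Longrightarrow> Ck_on k U g \<Longrightarrow> Ck_on k U (\<lambda>x. f x + g x)"
proof (induction k arbitrary: f g)
  case 0
  then show ?case by (simp add: continuous_on_add)
next
  case (Suc k)
  show ?case
    by (rule Ck_on_SucI[OF assms has_derivative_add[OF Suc.prems[THEN Ck_on_Suc_has_derivative]]])
      (use Suc in auto)
qed

lemma Ck_on_sum:
  assumes "open U" "\<And>i. i \<in> I \<Longrightarrow> Ck_on k U (f i)"
  shows "Ck_on k U (\<lambda>x. \<Sum>i\<in>I. f i x)"
  using assms(2)
  by (induction I rule: infinite_finite_induct) (auto intro: Ck_on_const Ck_on_add assms(1))

lemma Ck_on_bilinear:
  assumes "open U" "bounded_bilinear prd"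
  shows "Ck_on k U f \<Longrightarrow> Ck_on k U g \<Longrightarrow> Ck_on k U (\<lambda>x. prd (f x) (g x))"
proof (induction k arbitrary: f g)
  case 0
  then show ?case by (auto intro: bounded_bilinear.continuous_on[OF assms(2)])
next
  case (Suc k)
  have "Ck_on k U (\<lambda>x. prd (f x) (frechet_derivative g (at x) v)
      + prd (frechet_derivative f (at x) v) (g x))" for v
    by (rule Ck_on_add[OF assms(1) Suc.IH Suc.IH])
      (use Suc.prems[THEN Ck_on_SucD] Suc.prems in auto)
  moreover have "((\<lambda>x. prd (f x) (g x)) has_derivative
      (\<lambda>v. prd (f x) (frechet_derivative g (at x) v) + prd (frechet_derivative f (at x) v) (g x))) (at x)"
    if "x \<in> U" for x
    using Suc.prems that by (intro bounded_bilinear.FDERIV[OF assms(2)] Ck_on_Suc_has_derivative)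
  ultimately show ?case
    by (intro Ck_on_SucI[OF assms(1)])
qed

lemmas Ck_on_scaleR = Ck_on_bilinear[OF _ bounded_bilinear_scaleR]

lemma Ck_on_inner_const:
  "open U \<Longrightarrow> Ck_on k U f \<Longrightarrow> Ck_on k U (\<lambda>x. f x \<bullet> b)"
  using Ck_on_bilinear[OF _ bounded_bilinear_inner, of U k f "\<lambda>_. b"] by (simp add: Ck_on_const)

lemma linear_eq_sum_Basis:
  fixes L :: "'a::euclidean_space \<Rightarrow> 'b::real_vector"
  assumes "linear L"
  shows "L v = (\<Sum>b\<in>Basis. (v \<bullet> b) *\<^sub>R L b)"
proof -
  have "L v = L (\<Sum>b\<in>Basis. (v \<bullet> b) *\<^sub>R b)" by (simp add: euclidean_representation)
  also have "\<dots> = (\<Sum>b\<in>Basis. (v \<bullet> b) *\<^sub>R L b)"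
    by (simp add: linear_sum[OF assms] linear_cmul[OF assms])
  finally show ?thesis .
qed

text \<open>In the chain rule the derivative at \<open>g x\<close> acts on a vector that moves with
  \<open>x\<close>. Expanding that vector over the basis leaves scalar functions times derivatives
  in fixed directions, which are what \<open>Ck_on\<close> controls.\<close>

lemma Ck_on_linear_family_apply:
  fixes L :: "'a::euclidean_space \<Rightarrow> 'b::euclidean_space \<Rightarrow> 'c::euclidean_space"
  assumes "open U" "\<And>x. x \<in> U \<Longrightarrow> linear (L x)"
    and "\<And>b. Ck_on k U (\<lambda>x. L x b)" and "Ck_on k U z"
  shows "Ck_on k U (\<lambda>x. L x (z x))"
proof -
  have "Ck_on k U (\<lambda>x. \<Sum>b\<in>Basis. (z x \<bullet> b) *\<^sub>R L x b)"
    using assms by (intro Ck_on_sum Ck_on_scaleR Ck_on_inner_const) auto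
  moreover have "L x (z x) = (\<Sum>b\<in>Basis. (z x \<bullet> b) *\<^sub>R L x b)" if "x \<in> U" for x
    by (rule linear_eq_sum_Basis[OF assms(2)[OF that]])
  ultimately show ?thesis
    using Ck_on_cong[OF assms(1), of "\<lambda>x. L x (z x)" "\<lambda>x. \<Sum>b\<in>Basis. (z x \<bullet> b) *\<^sub>R L x b" k]
    by simp
qed

lemma Ck_on_compose:
  fixes f :: "'b::euclidean_space \<Rightarrow> 'c::euclidean_space" and g :: "'a::euclidean_space \<Rightarrow> 'b"
  assumes "open U" "open V" "g ` U \<subseteq> V"
  shows "Ck_on k V f \<Longrightarrow> Ck_on k U g \<Longrightarrow> Ck_on k U (\<lambda>x. f (g x))"
proof (induction k arbitrary: f)
  case 0
  then show ?case using assms(3) continuous_on_compose2 by auto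
next
  case (Suc k)
  let ?f' = "\<lambda>x. frechet_derivative f (at x)" and ?g' = "\<lambda>x. frechet_derivative g (at x)"
  show ?case
  proof (rule Ck_on_SucI[OF assms(1), where f' = "\<lambda>x v. ?f' (g x) (?g' x v)"])
    fix x assume "x \<in> U"
    then show "((\<lambda>x. f (g x)) has_derivative (\<lambda>v. ?f' (g x) (?g' x v))) (at x)"
      using Suc.prems assms(3)
      by (intro has_derivative_compose[of g _ _ _ f]) (auto intro!: Ck_on_Suc_has_derivative)
  next
    fix v
    show "Ck_on k U (\<lambda>x. ?f' (g x) (?g' x v))"
    proof (rule Ck_on_linear_family_apply[OF assms(1), where L = "\<lambda>x. ?f' (g x)"])
      show "linear (?f' (g x))" if "x \<in> U" for x
        using Suc.prems(1) assms(3) that linear_frechet_derivative by auto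
      show "Ck_on k U (\<lambda>x. ?f' (g x) b)" for b
        using Suc.prems by (intro Suc.IH Ck_on_SucD[of k U g]) auto
      show "Ck_on k U (\<lambda>x. ?g' x v)"
        using Suc.prems(2) by simp
    qed
  qed
qed

section \<open>Inverses of families of linear maps and the smooth inverse function theorem\<close>

lemma linear_family_bounded_below:
  fixes P :: "'a::topological_space \<Rightarrow> 'b::euclidean_space \<Rightarrow> 'c::euclidean_space"
  assumes lin: "linear (P y0)" "\<forall>\<^sub>F y in at y0. linear (P y)" and inj: "inj (P y0)"
    and cont: "\<And>b. ((\<lambda>y. P y b) \<longlongrightarrow> P y0 b) (at y0)"
  shows "\<exists>c>0. \<forall>\<^sub>F y in at y0. \<forall>x. c * norm x \<le> norm (P y x)"
proof -
  obtain B where B: "B > 0" "\<And>x. B * norm x \<le> norm (P y0 x)"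
    using linear_inj_bounded_below_pos[OF lin(1) inj] by blast
  \<comment> \<open>The sum of the deviations on the basis dominates the operator norm of
    \<open>P y - P y0\<close>, so convergence on each basis vector preserves half of the lower bound
    \<open>B\<close>.\<close>
  have "((\<lambda>y. \<Sum>b\<in>Basis. norm (P y b - P y0 b)) \<longlongrightarrow> (\<Sum>b\<in>(Basis::'b set). 0)) (at y0)"
    by (intro tendsto_sum tendsto_norm_zero) (use cont in \<open>simp add: LIM_zero_iff\<close>)
  then have "\<forall>\<^sub>F y in at y0. (\<Sum>b\<in>(Basis::'b set). norm (P y b - P y0 b)) < B/2"
    using B(1) by (intro order_tendstoD) auto
  with lin(2) have "\<forall>\<^sub>F y in at y0. \<forall>x. B/2 * norm x \<le> norm (P y x)"
  proof eventually_elim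
    case (elim y)
    show ?case
    proof
      fix x
      have "norm (P y x - P y0 x) = norm (\<Sum>b\<in>Basis. (x \<bullet> b) *\<^sub>R (P y b - P y0 b))"
        by (subst (1 2) linear_eq_sum_Basis) (use elim lin in \<open>auto simp: sum_subtractf algebra_simps\<close>)
      also have "\<dots> \<le> (\<Sum>b\<in>Basis. norm x * norm (P y b - P y0 b))"
        by (intro sum_norm_le) (auto intro: mult_right_mono Basis_le_norm)
      also have "\<dots> \<le> B/2 * norm x"
        using elim(2) mult_left_mono[of "\<Sum>b\<in>Basis. norm (P y b - P y0 b)" "B/2" "norm x"]
        by (simp add: sum_distrib_left mult.commute)
      finally have "norm (P y0 x) - norm (P y x) \<le> B/2 * norm x"
        by (smt (verit) norm_triangle_ineq2 norm_minus_commute)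
      then show "B/2 * norm x \<le> norm (P y x)"
        using B(2)[of x] by simp
    qed
  qed
  then show ?thesis using B(1) by (intro exI[of _ "B/2"]) auto
qed

text \<open>Because \<open>s\<close> vanishes at \<open>x\<close>, replacing \<open>c y\<close> by
  \<open>c x\<close> costs only \<open>o(norm (y - x))\<close>, so continuity of \<open>c\<close> is
  enough. This allows an inverse to be differentiated before its differentiability is known.\<close>

lemma has_derivative_scaleR_at_zero:
  fixes s :: "'a::real_normed_vector \<Rightarrow> real" and c :: "'a \<Rightarrow> 'b::real_normed_vector"
  assumes s: "(s has_derivative s') (at x)" and "s x = 0" and c: "isCont c x"
  shows "((\<lambda>y. s y *\<^sub>R c y) has_derivative (\<lambda>u. s' u *\<^sub>R c x)) (at x)"
proof -
  let ?R = "\<lambda>y. norm (s y - s x - s' (y - x)) / norm (y - x)"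
  have bl: "bounded_linear s'"
    using s by (rule has_derivative_bounded_linear)
  have R: "?R \<midarrow>x\<rightarrow> 0"
    using s by (simp add: has_derivative_iff_norm)
  have "((\<lambda>y. s y *\<^sub>R (c y - c x)) has_derivative (\<lambda>u. 0)) (at x)"
    unfolding has_derivative_iff_norm
  proof (intro conjI)
    have "(\<lambda>y. (?R y + onorm s') * norm (c y - c x)) \<midarrow>x\<rightarrow> (0 + onorm s') * 0"
      using c by (intro tendsto_mult tendsto_add R tendsto_const tendsto_norm_zero)
        (simp add: isCont_def LIM_zero_iff)
    then have lim: "(\<lambda>y. (?R y + onorm s') * norm (c y - c x)) \<midarrow>x\<rightarrow> 0" by simp
    have bound: "\<bar>s y\<bar> / norm (y - x) \<le> ?R y + onorm s'" if "y \<noteq> x" for y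
    proof -
      have "\<bar>s y\<bar> \<le> norm (s y - s x - s' (y - x)) + onorm s' * norm (y - x)"
        using onorm[OF bl, of "y - x"] \<open>s x = 0\<close> by (auto simp: abs_le_iff)
      then show ?thesis
        using that by (simp add: field_simps)
    qed
    have *: "norm (s y *\<^sub>R (c y - c x)) / norm (y - x) \<le> (?R y + onorm s') * norm (c y - c x)"
      if "y \<noteq> x" for y
      using mult_right_mono[OF bound[OF that], of "norm (c y - c x)"] by simp
    show "(\<lambda>y. norm (s y *\<^sub>R (c y - c x) - s x *\<^sub>R (c x - c x) - 0) / norm (y - x)) \<midarrow>x\<rightarrow> 0"
      by (rule tendsto_sandwich[OF _ _ tendsto_const lim])
        (use * in \<open>auto simp: eventually_at_filter\<close>)
  qed auto
  moreover have "((\<lambda>y. s y *\<^sub>R c x) has_derivative (\<lambda>u. s' u *\<^sub>R c x)) (at x)"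
    using s by (auto intro!: derivative_eq_intros)
  ultimately show ?thesis
    using has_derivative_add by (fastforce simp: algebra_simps)
qed

text \<open>With \<open>w = inv (P x) v\<close>, the identity
  \<open>inv (P y) v = w - inv (P y) (P y w - P x w)\<close> writes the increment as a continuous
  inverse applied to something that vanishes at \<open>y = x\<close>. The resulting derivative
  involves only the inverses and the derivatives of the family, so the class rises by one in each
  induction step.\<close>

lemma Ck_on_inv_linear_family:
  fixes P :: "'a::euclidean_space \<Rightarrow> 'b::euclidean_space \<Rightarrow> 'b"
  assumes U: "open U" and lin: "\<And>x. x \<in> U \<Longrightarrow> linear (P x)" and bij: "\<And>x. x \<in> U \<Longrightarrow> bij (P x)"
  shows "(\<And>w. Ck_on k U (\<lambda>x. P x w)) \<Longrightarrow> Ck_on k U (\<lambda>x. inv (P x) v)"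
proof (induction k arbitrary: v)
  case 0
  have "((\<lambda>y. inv (P y) v) \<longlongrightarrow> inv (P x) v) (at x)" if x: "x \<in> U" for x
  proof -
    have lim: "((\<lambda>y. P y b) \<longlongrightarrow> P x b) (at x)" for b
      using 0 that U by (simp add: continuous_on_eq_continuous_at isCont_def)
    have evU: "\<forall>\<^sub>F y in at x. y \<in> U"
      using U that by (rule eventually_at_in_open')
    have "\<forall>\<^sub>F y in at x. linear (P y)"
      using evU by eventually_elim (rule lin)
    then obtain c where c: "c > 0" "\<forall>\<^sub>F y in at x. \<forall>w. c * norm w \<le> norm (P y w)"
      using linear_family_bounded_below[of P x, OF lin[OF x] _ bij_is_inj[OF bij[OF x]] lim]
      by blast
    let ?w = "inv (P x) v"
    \<comment> \<open>The lower bound \<open>c\<close> turns convergence of \<open>P y ?w\<close> to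
      \<open>P x ?w = v\<close> into convergence of the preimages of \<open>v\<close>.\<close>
    have "((\<lambda>y. norm (P x ?w - P y ?w) / c) \<longlongrightarrow> 0) (at x)"
      using tendsto_divide[OF tendsto_norm_zero[OF LIM_zero[OF lim[of ?w]]] tendsto_const[of c]] c(1)
      by (simp add: norm_minus_commute)
    then have "((\<lambda>y. inv (P y) v - ?w) \<longlongrightarrow> 0) (at x)"
    proof (rule Lim_null_comparison[rotated])
      show "\<forall>\<^sub>F y in at x. norm (inv (P y) v - ?w) \<le> norm (P x ?w - P y ?w) / c"
        using c(2) evU
      proof eventually_elim
        case (elim y)
        have "P y (inv (P y) v - ?w) = P x ?w - P y ?w"
          using elim(2) that by (simp add: linear_diff lin surj_f_inv_f bij_is_surj bij)
        then show ?case
          using elim(1) c(1) by (metis mult.commute pos_le_divide_eq)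
      qed
    qed
    then show ?thesis by (rule LIM_zero_cancel)
  qed
  then show ?case
    using U by (simp add: continuous_on_eq_continuous_at isCont_def)
next
  case (Suc k)
  let ?h = "\<lambda>v x. inv (P x) v"
  let ?dP = "\<lambda>c x. frechet_derivative (\<lambda>x. P x c) (at x)"
  \<comment> \<open>This is the derivative at \<open>x\<close> of \<open>P\<close> evaluated at the
    vector \<open>?h v x\<close>. It is expanded over the basis since that vector moves with
    \<open>x\<close> when the smoothness of the derivative is checked.\<close>
  let ?D = "\<lambda>x u. \<Sum>c\<in>Basis. (?h v x \<bullet> c) *\<^sub>R ?dP c x u"
  have IH: "Ck_on k U (?h w)" for w
    by (rule Suc.IH[OF Ck_on_SucD[OF Suc.prems]])
  show ?case
  proof (rule Ck_on_SucI[OF U, where f' = "\<lambda>x u. - (\<Sum>b\<in>Basis. (?D x u \<bullet> b) *\<^sub>R ?h b x)"])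
    fix x assume x: "x \<in> U"
    let ?w = "?h v x"
    let ?q = "\<lambda>y. \<Sum>c\<in>Basis. (?w \<bullet> c) *\<^sub>R (P y c - P x c)"
    have q: "?q y = P y ?w - P x ?w" if "y \<in> U" for y
      using linear_eq_sum_Basis[OF lin[OF that], of ?w] linear_eq_sum_Basis[OF lin[OF x], of ?w]
      by (simp add: scaleR_diff_right sum_subtractf)
    have "?h v y = ?w - (\<Sum>b\<in>Basis. (?q y \<bullet> b) *\<^sub>R ?h b y)" if "y \<in> U" for y
    proof -
      have li: "linear (inv (P y))"
        using lin[OF that] bij[OF that] by (simp add: linear_injective_imp_surjective bij_is_inj
            inj_linear_imp_inv_linear)
      have "(\<Sum>b\<in>Basis. (?q y \<bullet> b) *\<^sub>R ?h b y) = inv (P y) (P y ?w - P x ?w)"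
        using linear_eq_sum_Basis[OF li] q[OF that] by metis
      also have "\<dots> = ?w - inv (P y) v"
        using bij x that by (simp add: linear_diff[OF li] bij_is_inj bij_is_surj surj_f_inv_f)
      finally show ?thesis by simp
    qed
    moreover have "((\<lambda>y. ?w - (\<Sum>b\<in>Basis. (?q y \<bullet> b) *\<^sub>R ?h b y)) has_derivative
        (\<lambda>u. 0 - (\<Sum>b\<in>Basis. (?D x u \<bullet> b) *\<^sub>R ?h b x))) (at x)"
    proof (intro has_derivative_diff has_derivative_const has_derivative_sum
        has_derivative_scaleR_at_zero)
      fix b :: 'b
      have "((\<lambda>y. P y c) has_derivative ?dP c x) (at x)" for c
        using Suc.prems x by (rule Ck_on_Suc_has_derivative)
      then have "(?q has_derivative ?D x) (at x)"
        by (auto intro!: derivative_eq_intros)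
      then show "((\<lambda>y. ?q y \<bullet> b) has_derivative (\<lambda>u. ?D x u \<bullet> b)) (at x)"
        by (rule has_derivative_inner_left)
      show "isCont (?h b) x"
        using Ck_on_imp_continuous_on[OF IH] U x continuous_on_eq_continuous_at by blast
    qed auto
    ultimately show "(?h v has_derivative (\<lambda>u. - (\<Sum>b\<in>Basis. (?D x u \<bullet> b) *\<^sub>R ?h b x))) (at x)"
      using has_derivative_transform_within_open[OF _ U x,
          of "\<lambda>y. ?w - (\<Sum>b\<in>Basis. (?q y \<bullet> b) *\<^sub>R ?h b y)" _ UNIV "?h v"]
      by simp
  next
    fix u
    have "Ck_on k U (\<lambda>x. ?dP c x u)" for c
      using Suc.prems by simp
    then have "Ck_on k U (\<lambda>x. \<Sum>b\<in>Basis. (?D x u \<bullet> b) *\<^sub>R ?h b x)"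
      by (intro Ck_on_sum Ck_on_scaleR Ck_on_inner_const U IH)
    then show "Ck_on k U (\<lambda>x. - (\<Sum>b\<in>Basis. (?D x u \<bullet> b) *\<^sub>R ?h b x))"
      using Ck_on_scaleR[OF U Ck_on_const[OF U, of k "-1"]] by fastforce
  qed
qed

text \<open>The continuously differentiable version gives \<open>G' y\<close> as the inverse of
  \<open>F' (G y)\<close>. If \<open>G\<close> is of class \<open>C\<^sup>k\<close>, then so is this
  family of inverses, and \<open>G\<close> gains one more derivative.\<close>

theorem smooth_inverse_function:
  fixes F :: "'a::euclidean_space \<Rightarrow> 'a"
  assumes smooth: "\<And>k. Ck_on k UNIV F" and inj: "inj (frechet_derivative F (at x0))"
  obtains U V G where "open U" "open V" "x0 \<in> U" "homeomorphism U V F G" "\<And>k. Ck_on k V G"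
proof -
  define F' where "F' x = Blinfun (frechet_derivative F (at x))" for x
  have der: "(F has_derivative frechet_derivative F (at x)) (at x)" for x
    using smooth[of 1] by (simp add: frechet_derivative_works)
  have F': "blinfun_apply (F' x) = frechet_derivative F (at x)" for x
    unfolding F'_def using der has_derivative_bounded_linear bounded_linear_Blinfun_apply by blast
  have "continuous_on UNIV F'"
  proof (rule continuous_on_blinfun_componentwise)
    show "continuous_on UNIV (\<lambda>x. F' x b)" for b
      using smooth[of "Suc 0"] by (simp add: F')
  qed
  obtain L where L: "linear L" "L \<circ> frechet_derivative F (at x0) = id"
    using linear_injective_left_inverse[OF has_derivative_linear[OF der] inj] by auto
  then have "Blinfun L o\<^sub>L F' x0 = id_blinfun"
    by (intro blinfun_eqI)
      (simp add: F' bounded_linear_Blinfun_apply linear_conv_bounded_linear[symmetric] o_def fun_eq_iff)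
  then obtain U V G G' where UV: "open U" "x0 \<in> U" "open V" "homeomorphism U V F G"
    and G: "\<And>y. y \<in> V \<Longrightarrow> (G has_derivative G' y) (at y)"
    and G': "\<And>y. y \<in> V \<Longrightarrow> G' y = inv (F' (G y))"
    and bij: "\<And>y. y \<in> V \<Longrightarrow> bij (F' (G y))"
    using inverse_function_theorem[of UNIV F F' x0 "Blinfun L"] der F' \<open>continuous_on UNIV F'\<close>
    by (metis UNIV_I open_UNIV)
  have "Ck_on k V G" for k
  proof (induction k)
    case 0
    then show ?case using UV by (simp add: homeomorphism_def)
  next
    case (Suc k)
    have "Ck_on k V (\<lambda>y. F' (G y) w)" for w
    proof (rule Ck_on_compose[OF \<open>open V\<close> open_UNIV _ _ Suc])
      show "Ck_on k UNIV (\<lambda>x. F' x w)"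
        using smooth[of "Suc k"] by (simp add: F')
    qed auto
    then have "Ck_on k V (\<lambda>y. inv (F' (G y)) v)" for v
      by (intro Ck_on_inv_linear_family[OF \<open>open V\<close>] bij)
        (auto intro: bounded_linear.linear blinfun.bounded_linear_right)
    then have "Ck_on k V (\<lambda>y. G' y v)" for v
      using Ck_on_cong[OF \<open>open V\<close>, of "\<lambda>y. G' y v" "\<lambda>y. inv (F' (G y)) v" k] G' by simp
    then show ?case
      by (intro Ck_on_SucI[OF \<open>open V\<close> G])
  qed
  with UV that show ?thesis by blast
qed

section \<open>The matrix exponential\<close>

lemma bounded_bilinear_matrix_mult:
  "bounded_bilinear ((**) :: real^'n^'m \<Rightarrow> real^'k^'n \<Rightarrow> real^'k^'m)"
  unfolding bilinear_conv_bounded_bilinear[symmetric] bilinear_def linear_iff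
  by (simp add: matrix_matrix_mult_def vec_eq_iff sum.distrib algebra_simps sum_distrib_left)

interpretation matrix_mult: bounded_bilinear "(**) :: real^'n^'m \<Rightarrow> real^'k^'n \<Rightarrow> real^'k^'m"
  by (rule bounded_bilinear_matrix_mult)

lemma bounded_bilinear_matrix_vector_mult:
  "bounded_bilinear ((*v) :: real^'n^'m \<Rightarrow> real^'n \<Rightarrow> real^'m)"
  unfolding bilinear_conv_bounded_bilinear[symmetric] bilinear_def linear_iff
  by (simp add: matrix_vector_mult_def vec_eq_iff sum.distrib algebra_simps sum_distrib_left)

interpretation matrix_vector_mult: bounded_bilinear "(*v) :: real^'n^'m \<Rightarrow> real^'n \<Rightarrow> real^'m"
  by (rule bounded_bilinear_matrix_vector_mult)

lemma bounded_linear_transpose: "bounded_linear (transpose :: real^'n^'m \<Rightarrow> real^'m^'n)"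
  by (rule linear_conv_bounded_linear[THEN iffD1])
    (simp add: linear_iff transpose_def vec_eq_iff)

section \<open>Power series for the iterated derivatives of the exponential\<close>

primrec insertions :: "'a \<Rightarrow> 'a list \<Rightarrow> 'a list list" where
  "insertions u [] = [[u]]"
| "insertions u (v # vs) = (u # v # vs) # map ((#) v) (insertions u vs)"

lemma length_insertions: "length (insertions u vs) = Suc (length vs)"
  by (induction vs) auto

lemma set_insertions: "ws \<in> set (insertions u vs) \<Longrightarrow> set ws \<subseteq> insert u (set vs)"
  by (induction vs arbitrary: ws) fastforce+

text \<open>
  \<open>word_sum k vs X\<close> is the sum of all products of \<open>k\<close> factors in which the members of \<open>vs\<close>
  occur once each and in this order, all other factors being \<open>X\<close>. These are up to a factor
  the derivatives of \<open>X\<^sup>k\<close>: differentiating in direction \<open>u\<close> inserts \<open>u\<close> into \<open>vs\<close> at every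
  possible place.
\<close>

primrec word_sum :: "nat \<Rightarrow> (real^'n^'n) list \<Rightarrow> real^'n^'n \<Rightarrow> real^'n^'n" where
  "word_sum 0 vs X = (if vs = [] then mat 1 else 0)"
| "word_sum (Suc k) vs X =
     X ** word_sum k vs X + (case vs of [] \<Rightarrow> 0 | v # vs' \<Rightarrow> v ** word_sum k vs' X)"

lemma sum_list_mult_left: "A ** sum_list xs = (\<Sum>x\<leftarrow>xs. A ** (x :: real^'n^'n))"
  by (induction xs) (simp_all add: matrix_mult.zero_right matrix_mult.add_right)

lemma has_derivative_word_sum:
  "(word_sum k vs has_derivative (\<lambda>u. \<Sum>ws\<leftarrow>insertions u vs. word_sum k ws X)) (at X)"
proof (induction k arbitrary: vs)
  case 0
  have "(\<Sum>ws\<leftarrow>insertions u vs. word_sum 0 ws X) = 0" for u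
    by (induction vs) (auto simp: o_def sum_list_0)
  then show ?case by (simp add: has_derivative_const)
next
  case (Suc k)
  show ?case
  proof (cases vs)
    case Nil
    have "((\<lambda>X. X ** word_sum k [] X) has_derivative
        (\<lambda>u. X ** (\<Sum>ws\<leftarrow>insertions u []. word_sum k ws X) + u ** word_sum k [] X)) (at X)"
      by (intro matrix_mult.FDERIV has_derivative_ident Suc.IH)
    then show ?thesis
      by (simp add: Nil)
  next
    case (Cons v vs')
    have "((\<lambda>X. X ** word_sum k vs X + v ** word_sum k vs' X) has_derivative
        (\<lambda>u. (X ** (\<Sum>ws\<leftarrow>insertions u vs. word_sum k ws X) + u ** word_sum k vs X)
          + (v ** (\<Sum>ws\<leftarrow>insertions u vs'. word_sum k ws X) + 0 ** word_sum k vs' X))) (at X)"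
      by (intro has_derivative_add matrix_mult.FDERIV has_derivative_ident has_derivative_const Suc.IH)
    then show ?thesis
      by (simp add: Cons matrix_mult.zero_left matrix_mult.add_right sum_list_mult_left o_def
          sum_list_addf algebra_simps)
  qed
qed

text \<open>Each recursion step produces at most two products, whence the factor 2; \<open>K\<close>
  is the constant of the product in the Frobenius norm. The bound is independent of the length of
  \<open>vs\<close>.\<close>

lemma norm_word_sum_le:
  fixes X :: "real^'n^'n"
  assumes K: "K > 0" "\<And>(A :: real^'n^'n) (B :: real^'n^'n). norm (A ** B) \<le> norm A * norm B * K"
    and "norm X \<le> r"
  shows "(\<forall>v\<in>set vs. norm v \<le> r) \<Longrightarrow>
    norm (word_sum k vs X) \<le> (2 * K * r) ^ k * norm (mat 1 :: real^'n^'n)"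
proof (induction k arbitrary: vs)
  case (Suc k)
  have "r \<ge> 0" using assms(3) norm_ge_zero order_trans by blast
  let ?c = "norm (mat 1 :: real^'n^'n)"
  have step: "norm (A ** word_sum k ws X) \<le> K * r * ((2 * K * r) ^ k * ?c)"
    if "norm A \<le> r" "\<forall>v\<in>set ws. norm v \<le> r" for A :: "real^'n^'n" and ws
  proof -
    have "norm (A ** word_sum k ws X) \<le> norm A * norm (word_sum k ws X) * K"
      by (rule K(2))
    also have "\<dots> \<le> r * ((2 * K * r) ^ k * ?c) * K"
      using that K(1) \<open>r \<ge> 0\<close> by (intro mult_right_mono mult_mono Suc.IH) auto
    finally show ?thesis by (simp add: mult_ac)
  qed
  have "norm (word_sum (Suc k) vs X) \<le> 2 * (K * r * ((2 * K * r) ^ k * ?c))"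
  proof (cases vs)
    case Nil
    have "0 \<le> K * r * ((2 * K * r) ^ k * ?c)" using K(1) \<open>r \<ge> 0\<close> by auto
    then show ?thesis using step[OF assms(3), of vs] Nil by simp
  next
    case (Cons v vs')
    then show ?thesis
      using step[OF assms(3), of vs] step[of v vs'] Suc.prems
        norm_triangle_ineq[of "X ** word_sum k vs X" "v ** word_sum k vs' X"]
      by simp
  qed
  then show ?case by (simp add: mult_ac)
qed simp

lemma scaleR_sum_list: "c *\<^sub>R sum_list (map f xs) = (\<Sum>x\<leftarrow>xs. c *\<^sub>R (f x :: 'a::real_vector))"
  by (induction xs) (simp_all add: scaleR_add_right)

lemma norm_sum_list_le: "norm (sum_list (map f xs)) \<le> (\<Sum>x\<leftarrow>xs. norm (f x :: 'a::real_normed_vector))"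
  by (induction xs) (auto intro: norm_triangle_le)

text \<open>For a single direction this is the derivative of the exponential. For longer lists it is
  the part of the iterated derivative in which the directions occur in the given order; summing over
  all orders gives the whole.\<close>

definition exp_deriv :: "(real^'n^'n) list \<Rightarrow> real^'n^'n \<Rightarrow> real^'n^'n" where
  "exp_deriv vs X = (\<Sum>k. (1 / fact k) *\<^sub>R word_sum k vs X)"

lemma word_sum_Nil: "word_sum k [] X = ((**) X ^^ k) (mat 1)"
  by (induction k) auto

lemma exp_deriv_Nil: "exp_deriv [] = matrix_exp"
  by (rule ext) (simp add: exp_deriv_def matrix_exp_def word_sum_Nil)

text \<open>One exponential series majorises all these series at once, for points and directions in
  a common ball. It serves both for convergence and for termwise differentiation.\<close>

lemma word_sum_bound:
  obtains c b :: real where "c \<ge> 0"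
    "\<And>X k vs. norm (X :: real^'n^'n) \<le> R \<Longrightarrow> \<forall>v\<in>set vs. norm v \<le> R \<Longrightarrow>
      norm ((1 / fact k) *\<^sub>R word_sum k vs X) \<le> c * (b ^ k /\<^sub>R fact k)"
proof -
  obtain K where K: "K > 0" "\<And>(A :: real^'n^'n) (B :: real^'n^'n). norm (A ** B) \<le> norm A * norm B * K"
    using matrix_mult.pos_bounded by blast
  have "norm ((1 / fact k) *\<^sub>R word_sum k vs X)
      \<le> norm (mat 1 :: real^'n^'n) * ((2 * K * R) ^ k /\<^sub>R fact k)"
    if "norm (X :: real^'n^'n) \<le> R" "\<forall>v\<in>set vs. norm v \<le> R" for X k vs
    using norm_word_sum_le[OF K that] by (simp add: field_simps)
  then show ?thesis using that by (metis norm_ge_zero)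
qed

lemma exp_deriv_sums:
  fixes X :: "real^'n^'n"
  shows "(\<lambda>k. (1 / fact k) *\<^sub>R word_sum k vs X) sums exp_deriv vs X"
proof -
  obtain R where R: "\<forall>v\<in>set (X # vs). norm v \<le> R"
    using finite_imp_bounded[of "set (X # vs)"] bounded_iff by (metis List.finite_set)
  obtain c b where b: "norm ((1 / fact k) *\<^sub>R word_sum k vs X) \<le> c * (b ^ k /\<^sub>R fact k)" for k
    using word_sum_bound[where 'n = 'n, of R] R by (metis list.set_intros)
  have "summable (\<lambda>k. c * (b ^ k /\<^sub>R fact k))"
    by (intro summable_mult summable_exp_generic)
  then have "summable (\<lambda>k. (1 / fact k) *\<^sub>R word_sum k vs X)"
    by (rule summable_comparison_test'[where N = 0]) (rule b)
  then show ?thesis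
    unfolding exp_deriv_def by (rule summable_sums)
qed

lemma has_derivative_exp_deriv:
  fixes X :: "real^'n^'n"
  shows "(exp_deriv vs has_derivative (\<lambda>u. \<Sum>ws\<leftarrow>insertions u vs. exp_deriv ws X)) (at X)"
proof -
  obtain R0 where R0: "\<forall>v\<in>set (X # vs). norm v \<le> R0"
    using finite_imp_bounded[of "set (X # vs)"] bounded_iff by (metis List.finite_set)
  \<comment> \<open>The added 1 puts \<open>X\<close> inside the open ball, and
    \<open>R \<ge> 1\<close> admits unit directions, from which the bound \<open>DM\<close> for all
    directions follows by linearity.\<close>
  define R where "R = max R0 1 + 1"
  have R: "\<forall>v\<in>set vs. norm v \<le> R" "X \<in> ball 0 R" "R \<ge> 1"
    using R0 by (auto simp: R_def)
  obtain c b where c: "c \<ge> 0" and b: "\<And>Y k ws. norm (Y :: real^'n^'n) \<le> R \<Longrightarrow>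
      \<forall>v\<in>set ws. norm v \<le> R \<Longrightarrow> norm ((1 / fact k) *\<^sub>R word_sum k ws Y) \<le> c * (b ^ k /\<^sub>R fact k)"
    using word_sum_bound[where 'n = 'n, of R] by blast
  define D where "D k Y u = (1 / fact k) *\<^sub>R (\<Sum>ws\<leftarrow>insertions u vs. word_sum k ws Y)" for k Y u
  define M where "M k = Suc (length vs) * (c * (b ^ k /\<^sub>R fact k))" for k
  have sM: "summable M"
    unfolding M_def by (intro summable_mult summable_exp_generic)
  have der: "((\<lambda>Y. (1 / fact k) *\<^sub>R word_sum k vs Y) has_derivative D k Y) (at Y)" for k Y
    unfolding D_def by (intro has_derivative_scaleR_right has_derivative_word_sum)
  have DM1: "norm (D k Y u) \<le> M k" if "norm Y \<le> R" "norm u \<le> R" for k Y u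
  proof -
    have "D k Y u = (\<Sum>ws\<leftarrow>insertions u vs. (1 / fact k) *\<^sub>R word_sum k ws Y)"
      unfolding D_def by (simp add: scaleR_sum_list)
    also have "norm \<dots> \<le> (\<Sum>ws\<leftarrow>insertions u vs. norm ((1 / fact k) *\<^sub>R word_sum k ws Y))"
      by (rule norm_sum_list_le)
    also have "\<dots> \<le> (\<Sum>ws\<leftarrow>insertions u vs. c * (b ^ k /\<^sub>R fact k))"
      using set_insertions[of _ u vs] R(1) that by (intro sum_list_mono b) fastforce+
    also have "\<dots> = M k"
      by (simp add: M_def sum_list_triv length_insertions)
    finally show ?thesis .
  qed
  have DM: "norm (D k Y u) \<le> M k * norm u" if "norm Y \<le> R" for k Y u
  proof (cases "u = 0")
    case False
    have "D k Y u = norm u *\<^sub>R D k Y (u /\<^sub>R norm u)"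
      using linear_cmul[OF has_derivative_linear[OF der], of k Y "norm u" "u /\<^sub>R norm u"] False by simp
    then show ?thesis
      using DM1[OF that, of "u /\<^sub>R norm u" k] R(3) False
      by (simp add: mult.commute mult_left_mono)
  next
    case True
    then show ?thesis
      using linear_0[OF has_derivative_linear[OF der], of k Y] by simp
  qed
  let ?g' = "\<lambda>Y u. \<Sum>ws\<leftarrow>insertions u vs. exp_deriv ws Y"
  have Dsums: "(\<lambda>k. D k Y u) sums ?g' Y u" for Y u
  proof -
    have "(\<lambda>k. \<Sum>ws\<leftarrow>xs. (1 / fact k) *\<^sub>R word_sum k ws Y) sums (\<Sum>ws\<leftarrow>xs. exp_deriv ws Y)" for xs
      by (induction xs) (auto intro: sums_add exp_deriv_sums)
    then show ?thesis
      unfolding D_def by (simp add: scaleR_sum_list)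
  qed
  \<comment> \<open>Termwise differentiation: the tails of \<open>M\<close> bound the remainders of
    the differentiated series uniformly on the ball.\<close>
  have "\<exists>g. \<forall>Y\<in>ball 0 R. (\<lambda>k. (1 / fact k) *\<^sub>R word_sum k vs Y) sums g Y
      \<and> (g has_derivative ?g' Y) (at Y within ball 0 R)"
  proof (rule has_derivative_series[OF convex_ball has_derivative_at_withinI[OF der] _ R(2) exp_deriv_sums])
    fix e :: real assume "e > 0"
    then obtain N where N: "\<And>n. n \<ge> N \<Longrightarrow> norm (\<Sum>i. M (i + n)) < e"
      using suminf_exist_split[OF _ sM] by blast
    show "\<forall>\<^sub>F n in sequentially. \<forall>Y\<in>ball 0 R. \<forall>h. norm (sum (\<lambda>i. D i Y h) {..<n} - ?g' Y h) \<le> e * norm h"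
      unfolding eventually_sequentially
    proof (intro exI[of _ N] allI impI ballI)
      fix n and Y h :: "real^'n^'n" assume n: "n \<ge> N" and Y: "Y \<in> ball 0 R"
      have sD: "summable (\<lambda>i. D i Y h)"
        using Dsums by (rule sums_summable)
      have sMn: "summable (\<lambda>i. M (i + n) * norm h)"
        using sM by (intro summable_mult2 summable_ignore_initial_segment)
      have le: "norm (D (i + n) Y h) \<le> M (i + n) * norm h" for i
        using Y by (intro DM) simp
      have "?g' Y h - sum (\<lambda>i. D i Y h) {..<n} = (\<Sum>i. D (i + n) Y h)"
        using suminf_split_initial_segment[OF sD, of n] sums_unique[OF Dsums[of Y h]] by simp
      then have "norm (sum (\<lambda>i. D i Y h) {..<n} - ?g' Y h) = norm (\<Sum>i. D (i + n) Y h)"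
        by (metis norm_minus_commute)
      also have "\<dots> \<le> (\<Sum>i. M (i + n) * norm h)"
        by (rule norm_suminf_le[OF le sMn])
      also have "\<dots> = (\<Sum>i. M (i + n)) * norm h"
        by (intro suminf_mult2[symmetric] summable_ignore_initial_segment sM)
      also have "\<dots> \<le> e * norm h"
        using N[OF n] by (intro mult_right_mono) auto
      finally show "norm (sum (\<lambda>i. D i Y h) {..<n} - ?g' Y h) \<le> e * norm h" .
    qed
  qed
  then obtain g where g: "\<And>Y. Y \<in> ball 0 R \<Longrightarrow> (\<lambda>k. (1 / fact k) *\<^sub>R word_sum k vs Y) sums g Y"
      "\<And>Y. Y \<in> ball 0 R \<Longrightarrow> (g has_derivative ?g' Y) (at Y within ball 0 R)"
    by blast
  have "(g has_derivative ?g' X) (at X)"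
    using g(2)[OF R(2)] at_within_open[OF R(2) open_ball] by simp
  then show ?thesis
    by (rule has_derivative_transform_within_open[OF _ open_ball R(2)])
      (use g(1) exp_deriv_sums sums_unique2 in blast)
qed

lemma Ck_on_exp_deriv:
  fixes vs :: "(real^'n^'n) list"
  shows "Ck_on k UNIV (exp_deriv vs)"
proof (induction k arbitrary: vs)
  case 0
  show ?case
    using has_derivative_continuous[OF has_derivative_exp_deriv]
    by (auto intro: continuous_at_imp_continuous_on)
next
  case (Suc k)
  have "Ck_on k UNIV (\<lambda>X. \<Sum>ws\<leftarrow>xs. exp_deriv ws X)" for xs :: "(real^'n^'n) list list"
    by (induction xs) (auto intro: Ck_on_const Ck_on_add Suc.IH)
  then show ?case
    by (intro Ck_on_SucI[OF open_UNIV has_derivative_exp_deriv])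
qed

lemma Ck_on_matrix_exp: "Ck_on k U matrix_exp"
  using Ck_on_subset[OF subset_UNIV Ck_on_exp_deriv[of k "[]"]] by (simp add: exp_deriv_Nil)

lemma has_derivative_matrix_exp: "(matrix_exp has_derivative (\<lambda>u. exp_deriv [u] X)) (at X)"
  using has_derivative_exp_deriv[of "[]" X] by (simp add: exp_deriv_Nil)

lemma frechet_derivative_matrix_exp:
  "frechet_derivative matrix_exp (at X) = (\<lambda>u. exp_deriv [u] X)"
  by (rule frechet_derivative_at[OF has_derivative_matrix_exp, symmetric])

lemma linear_exp_deriv: "linear (\<lambda>u. exp_deriv [u] X)"
  using has_derivative_linear[OF has_derivative_matrix_exp] .

lemma matrix_exp_sums: "(\<lambda>k. (1 / fact k) *\<^sub>R word_sum k [] X) sums matrix_exp X"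
  using exp_deriv_sums[of "[]"] by (simp add: exp_deriv_Nil)

section \<open>Algebraic identities of the exponential\<close>

lemma matrix_exp_0 [simp]: "matrix_exp (0 :: real^'n^'n) = mat 1"
proof -
  have "(1 / fact k) *\<^sub>R word_sum k [] (0 :: real^'n^'n) = (if k = 0 then mat 1 else 0)" for k
    by (cases k) (simp_all add: matrix_mult.zero_left)
  then show ?thesis
    using sums_unique2[OF matrix_exp_sums[of "0 :: real^'n^'n"]]
      sums_single[of 0 "\<lambda>_. mat 1 :: real^'n^'n"] by simp
qed

lemma word_sum_commute:
  "X ** Y = Y ** X \<Longrightarrow> word_sum k [] X ** Y = Y ** word_sum k [] X"
  by (induction k) (simp_all flip: matrix_mul_assoc, simp add: matrix_mul_assoc)

lemma matrix_exp_commute: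
  fixes X Y :: "real^'n^'n"
  assumes "X ** Y = Y ** X"
  shows "matrix_exp X ** Y = Y ** matrix_exp X"
  using bounded_linear.sums[OF matrix_mult.bounded_linear_left matrix_exp_sums, of X Y]
    bounded_linear.sums[OF matrix_mult.bounded_linear_right matrix_exp_sums, of Y X]
  by (simp add: matrix_mult.scaleR_left matrix_mult.scaleR_right word_sum_commute[OF assms] sums_unique2)

lemma transpose_matrix_exp: "transpose (matrix_exp X) = matrix_exp (transpose X)"
proof -
  have "transpose (word_sum k [] X) = word_sum k [] (transpose X)" for k
    by (induction k) (simp_all add: matrix_transpose_mul word_sum_commute)
  then have "(\<lambda>k. (1 / fact k) *\<^sub>R word_sum k [] (transpose X)) sums transpose (matrix_exp X)"
    using bounded_linear.sums[OF bounded_linear_transpose matrix_exp_sums, of X]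
    by (simp add: transpose_scalar)
  then show ?thesis
    using matrix_exp_sums sums_unique2 by blast
qed

text \<open>
  Conjugation of \<open>X\<close> by the one-parameter group of \<open>Y\<close> conjugates \<open>matrix_exp X\<close> in the same way;
  this is the infinitesimal version.
\<close>

lemma exp_deriv_commutator:
  fixes X Y :: "real^'n^'n"
  shows "exp_deriv [X ** Y - Y ** X] X = matrix_exp X ** Y - Y ** matrix_exp X"
proof -
  \<comment> \<open>The sum of \<open>X^i (X Y - Y X) X^(k-1-i)\<close> over \<open>i < k\<close>
    telescopes.\<close>
  have ws: "word_sum k [X ** Y - Y ** X] X = word_sum k [] X ** Y - Y ** word_sum k [] X" for k
    by (induction k) (simp_all add: matrix_mult.diff_left matrix_mult.diff_right matrix_mul_assoc)
  have "(\<lambda>k. ((1 / fact k) *\<^sub>R word_sum k [] X) ** Y - Y ** ((1 / fact k) *\<^sub>R word_sum k [] X))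
      sums (matrix_exp X ** Y - Y ** matrix_exp X)"
    by (intro sums_diff bounded_linear.sums[OF matrix_mult.bounded_linear_left]
        bounded_linear.sums[OF matrix_mult.bounded_linear_right] matrix_exp_sums)
  then have "(\<lambda>k. (1 / fact k) *\<^sub>R word_sum k [X ** Y - Y ** X] X)
      sums (matrix_exp X ** Y - Y ** matrix_exp X)"
    by (simp add: ws matrix_mult.scaleR_left matrix_mult.scaleR_right scaleR_diff_right)
  then show ?thesis
    using exp_deriv_sums sums_unique2 by blast
qed

lemma exp_deriv_line:
  fixes X :: "real^'n^'n"
  shows "exp_deriv [X] (t *\<^sub>R X) = X ** matrix_exp (t *\<^sub>R X)"
proof -
  let ?p = "\<lambda>k. word_sum k [] (t *\<^sub>R X)"
  \<comment> \<open>All \<open>k + 1\<close> positions of the inserted \<open>X\<close> give the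
    same product, since the other factors are multiples of \<open>X\<close>.\<close>
  have ws: "word_sum (Suc k) [X] (t *\<^sub>R X) = real (Suc k) *\<^sub>R (X ** ?p k)" for k
  proof (induction k)
    case (Suc k)
    have "word_sum (Suc (Suc k)) [X] (t *\<^sub>R X)
        = (t *\<^sub>R X) ** (real (Suc k) *\<^sub>R (X ** ?p k)) + X ** ?p (Suc k)"
      by (subst word_sum.simps(2), subst Suc.IH) simp
    also have "(t *\<^sub>R X) ** (real (Suc k) *\<^sub>R (X ** ?p k)) = real (Suc k) *\<^sub>R (X ** ?p (Suc k))"
      by (simp add: matrix_mult.scaleR_left matrix_mult.scaleR_right)
    finally show ?case
      by (simp only: of_nat_Suc[of "Suc k"] scaleR_add_left scaleR_one add.commute)
  qed (simp add: matrix_mult.zero_right)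
  have "(\<lambda>k. X ** ((1 / fact k) *\<^sub>R ?p k)) sums (X ** matrix_exp (t *\<^sub>R X))"
    by (intro bounded_linear.sums[OF matrix_mult.bounded_linear_right] matrix_exp_sums)
  moreover have "X ** ((1 / fact k) *\<^sub>R ?p k)
      = (1 / fact (Suc k)) *\<^sub>R word_sum (Suc k) [X] (t *\<^sub>R X)" for k
  proof -
    have "1 / fact k = 1 / fact (Suc k) * real (Suc k)"
      by (simp add: fact_Suc del: of_nat_Suc)
    then show ?thesis
      unfolding ws by (simp only: matrix_mult.scaleR_right scaleR_scaleR)
  qed
  ultimately have "(\<lambda>k. (1 / fact (Suc k)) *\<^sub>R word_sum (Suc k) [X] (t *\<^sub>R X))
      sums (X ** matrix_exp (t *\<^sub>R X))"
    by simp
  \<comment> \<open>The term for \<open>k = 0\<close> is zero because an empty product has no room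
    for the inserted \<open>X\<close>, so the index shift does not change the sum.\<close>
  then have "(\<lambda>k. (1 / fact k) *\<^sub>R word_sum k [X] (t *\<^sub>R X)) sums (X ** matrix_exp (t *\<^sub>R X))"
    by (subst (asm) sums_Suc_iff) simp
  then show ?thesis
    using exp_deriv_sums sums_unique2 by blast
qed

lemma matrix_exp_has_vector_derivative:
  "((\<lambda>t. matrix_exp (t *\<^sub>R X)) has_vector_derivative X ** matrix_exp (t *\<^sub>R X)) (at t within S)"
proof -
  have "((\<lambda>t. matrix_exp (t *\<^sub>R X)) has_derivative (\<lambda>s. exp_deriv [s *\<^sub>R X] (t *\<^sub>R X))) (at t within S)"
    by (rule has_derivative_compose[OF _ has_derivative_matrix_exp]) (auto intro!: derivative_eq_intros)
  then show ?thesis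
    by (simp add: has_vector_derivative_def linear_cmul[OF linear_exp_deriv] exp_deriv_line)
qed

lemma vector_derivative_0_imp_eq:
  fixes f :: "real \<Rightarrow> 'a::real_normed_vector"
  assumes "\<And>t. (f has_vector_derivative 0) (at t)"
  shows "f s = f t"
  by (rule has_derivative_zero_unique[of UNIV f])
    (use assms in \<open>simp_all add: has_vector_derivative_def\<close>)

text \<open>Scaling all three exponents by \<open>t\<close> gives a curve with zero derivative that
  starts at the identity. The choice \<open>Y = X\<close> yields inverses, \<open>Y = X / 2\<close>
  yields square roots, and \<open>matrix_exp X = matrix_exp Y\<close> yields
  \<open>matrix_exp (Y - X) = mat 1\<close>.\<close>

lemma matrix_exp_commuting_product:
  fixes X Y :: "real^'n^'n"
  assumes XY: "X ** Y = Y ** X"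
  shows "matrix_exp X ** matrix_exp (- Y) ** matrix_exp (Y - X) = mat 1"
proof -
  let ?e = "\<lambda>Z t. matrix_exp (t *\<^sub>R Z)"
  let ?f = "\<lambda>t. ?e X t ** ?e (- Y) t ** ?e (Y - X) t"
  note simps = matrix_mult.scaleR_left matrix_mult.scaleR_right matrix_mult.minus_left
    matrix_mult.minus_right matrix_mult.diff_left matrix_mult.diff_right
    matrix_mult.add_left matrix_mult.add_right
  have "(?f has_vector_derivative 0) (at t)" for t
  proof -
    let ?a = "?e X t" and ?b = "?e (- Y) t" and ?c = "?e (Y - X) t"
    have comm: "?a ** X = X ** ?a" "?a ** Y = Y ** ?a" "?b ** X = X ** ?b" "?b ** Y = Y ** ?b"
      using XY by (simp_all add: matrix_exp_commute simps)
    have abZ: "?a ** ?b ** Z = Z ** ?a ** ?b" if "Z \<in> {X, Y}" for Z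
      using that comm by (metis insertE matrix_mul_assoc singletonD)
    have "(?f has_vector_derivative
        ?a ** ?b ** ((Y - X) ** ?c) + (?a ** ((- Y) ** ?b) + (X ** ?a) ** ?b) ** ?c) (at t)"
      by (intro matrix_mult.has_vector_derivative matrix_exp_has_vector_derivative)
    moreover have "?a ** ?b ** ((Y - X) ** ?c) = Y ** ?a ** ?b ** ?c - X ** ?a ** ?b ** ?c"
      using abZ[of X] abZ[of Y] by (simp add: simps matrix_mul_assoc)
    moreover have "(?a ** ((- Y) ** ?b) + (X ** ?a) ** ?b) ** ?c
        = X ** ?a ** ?b ** ?c - Y ** ?a ** ?b ** ?c"
      using comm(2) by (simp add: simps matrix_mul_assoc)
    ultimately show ?thesis by simp
  qed
  from vector_derivative_0_imp_eq[of ?f, OF this, of 1 0] show ?thesis by simp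
qed

lemma matrix_exp_minus: "matrix_exp X ** matrix_exp (- X) = mat 1"
  using matrix_exp_commuting_product[of X X] by simp

text \<open>The vector rotated by the angle \<open>t * \<phi>\<close> and then moved back by
  \<open>matrix_exp (- t B)\<close> has zero derivative in \<open>t\<close>; comparing
  \<open>t = 1\<close> with \<open>t = 0\<close> and inverting gives the formula.\<close>

lemma matrix_exp_rotation:
  fixes B :: "real^'n^'n"
  assumes "B *v x = \<phi> *\<^sub>R y" "B *v y = - \<phi> *\<^sub>R x"
  shows "matrix_exp B *v x = cos \<phi> *\<^sub>R x + sin \<phi> *\<^sub>R y"
proof -
  let ?v = "\<lambda>t. cos (t * \<phi>) *\<^sub>R x + sin (t * \<phi>) *\<^sub>R y"
  let ?f = "\<lambda>t. matrix_exp (t *\<^sub>R (- B)) *v ?v t"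
  have "(?f has_vector_derivative 0) (at t)" for t
  proof -
    let ?e = "matrix_exp (t *\<^sub>R (- B))"
    let ?v' = "(- (\<phi> * sin (t * \<phi>))) *\<^sub>R x + (\<phi> * cos (t * \<phi>)) *\<^sub>R y"
    have "(?v has_vector_derivative ?v') (at t)"
      by (auto intro!: derivative_eq_intros simp: algebra_simps)
    then have "(?f has_vector_derivative ?e *v ?v' + ((- B) ** ?e) *v ?v t) (at t)"
      by (intro matrix_vector_mult.has_vector_derivative matrix_exp_has_vector_derivative)
    moreover have "((- B) ** ?e) *v ?v t = ?e *v ((- B) *v ?v t)"
    proof -
      have "(t *\<^sub>R (- B)) ** (- B) = (- B) ** (t *\<^sub>R (- B))"
        by (simp only: matrix_mult.scaleR_left matrix_mult.scaleR_right)
      from matrix_exp_commute[OF this] show ?thesis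
        by (simp only: matrix_vector_mul_assoc)
    qed
    moreover have "(- B) *v ?v t = - ?v'"
      using assms by (simp add: matrix_vector_mult.minus_left matrix_vector_mult.add_right
          matrix_vector_mult.scaleR_right algebra_simps)
    ultimately show ?thesis
      by (simp only: matrix_vector_mult.minus_right add.right_inverse)
  qed
  from vector_derivative_0_imp_eq[of ?f, OF this, of 1 0]
  have "matrix_exp (- B) *v (cos \<phi> *\<^sub>R x + sin \<phi> *\<^sub>R y) = x" by simp
  then show ?thesis
    using matrix_exp_minus[of B] by (metis matrix_vector_mul_assoc matrix_vector_mul_lid)
qed

section \<open>Skew-symmetric matrices and injectivity\<close>

lemma skew_matrices_iff: "A \<in> skew_matrices \<longleftrightarrow> transpose A = - A"
  by (auto simp: skew_matrices_def eq_neg_iff_add_eq_0 add.commute)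

lemma subspace_skew_matrices: "subspace (skew_matrices :: (real^'n^'n) set)"
  by (auto simp: subspace_def skew_matrices_iff linear_0 linear_add linear_cmul
      bounded_linear.linear[OF bounded_linear_transpose])

lemma inner_transpose_matrix: "(transpose A *v x) \<bullet> y = x \<bullet> (A *v y)" for A :: "real^'n^'m"
  by (simp add: dot_lmul_matrix)

lemma skew_inner:
  assumes "A \<in> skew_matrices" shows "(A *v x) \<bullet> y = - (x \<bullet> (A *v y))"
proof -
  have "x \<bullet> (A *v y) = (- A *v x) \<bullet> y"
    using inner_transpose_matrix[of A x y] assms by (simp only: skew_matrices_iff)
  then show ?thesis by (simp add: matrix_vector_mult.minus_left)
qed

lemma skew_matricesI:
  assumes "\<And>x y. (A *v x) \<bullet> y = - (x \<bullet> (A *v y))" shows "A \<in> skew_matrices"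
proof -
  have "(transpose A *v x) \<bullet> y = (- A *v x) \<bullet> y" for x y
    unfolding inner_transpose_matrix by (simp add: assms matrix_vector_mult.minus_left)
  then have "transpose A *v x = - A *v x" for x
    using vector_eq_rdot by blast
  then show ?thesis
    unfolding skew_matrices_iff matrix_eq by blast
qed

lemma commutator_skew:
  assumes "X \<in> skew_matrices" "Y \<in> skew_matrices"
  shows "X ** Y - Y ** X \<in> skew_matrices"
  using assms unfolding skew_matrices_iff
  by (simp add: linear_diff[OF bounded_linear.linear[OF bounded_linear_transpose]]
      matrix_transpose_mul matrix_mult.minus_left matrix_mult.minus_right)

lemma transpose_matrix_exp_skew:
  "X \<in> skew_matrices \<Longrightarrow> transpose (matrix_exp X) = matrix_exp (- X)"
  by (simp add: transpose_matrix_exp skew_matrices_iff)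

lemma matrix_exp_minus': "matrix_exp (- X) ** matrix_exp X = mat 1"
  using matrix_exp_minus[of "- X"] by simp

text \<open>Multiplying \<open>matrix_exp X\<close> by the square of
  \<open>matrix_exp (- X / 2)\<close> gives the identity, so the determinant is the reciprocal of a
  nonzero square.\<close>

lemma det_matrix_exp_pos: "det (matrix_exp X) > 0"
proof -
  let ?h = "(1 / 2) *\<^sub>R X"
  have h: "?h - X = - ?h" using scaleR_left_distrib[of "1/2" "1/2" X] by (simp add: algebra_simps)
  then have "matrix_exp X ** matrix_exp (- ?h) ** matrix_exp (- ?h) = mat 1"
    using matrix_exp_commuting_product[of X ?h, unfolded h]
    by (simp add: matrix_mult.scaleR_left matrix_mult.scaleR_right)
  from arg_cong[OF this, of det]
  have "det (matrix_exp X) * (det (matrix_exp (- ?h)) * det (matrix_exp (- ?h))) = 1"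
    by (simp only: det_mul det_I mult.assoc)
  moreover from this have "det (matrix_exp (- ?h)) * det (matrix_exp (- ?h)) > 0"
    by (metis mult_zero_right zero_neq_one not_real_square_gt_zero)
  ultimately show ?thesis
    by (metis zero_less_mult_pos2 zero_less_one)
qed

lemma matrix_exp_special_orthogonal:
  assumes "X \<in> skew_matrices" shows "matrix_exp X \<in> special_orthogonal"
proof -
  have orth: "transpose (matrix_exp X) ** matrix_exp X = mat 1"
    using assms by (simp add: transpose_matrix_exp_skew matrix_exp_minus')
  then have "(det (matrix_exp X))\<^sup>2 = 1"
    by (metis det_I det_mul det_transpose power2_eq_square)
  then show ?thesis
    using det_matrix_exp_pos[of X] orth by (auto simp: special_orthogonal_def power2_eq_1_iff)
qed

section \<open>The conjugate locus through kernel vectors of the derivative\<close>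

lemma dim_image_less_iff:
  fixes f :: "'a::euclidean_space \<Rightarrow> 'b::euclidean_space"
  assumes f: "linear f" and S: "subspace S"
  shows "dim (f ` S) < dim S \<longleftrightarrow> (\<exists>x\<in>S. x \<noteq> 0 \<and> f x = 0)"
proof
  assume "dim (f ` S) < dim S"
  then have "\<not> inj_on f (span S)"
    using dim_image_eq[OF f] by (metis less_irrefl)
  then show "\<exists>x\<in>S. x \<noteq> 0 \<and> f x = 0"
    using linear_inj_on_iff_eq_0[OF f S] S by (auto simp: span_eq_iff[THEN iffD2])
next
  assume "\<exists>x\<in>S. x \<noteq> 0 \<and> f x = 0"
  then obtain x where x: "x \<in> S" "x \<noteq> 0" "f x = 0" by blast
  \<comment> \<open>A basis of \<open>S\<close> through the kernel vector: the image is already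
    spanned by the images of the other basis vectors.\<close>
  obtain B where B: "{x} \<subseteq> B" "B \<subseteq> S" "independent B" "S \<subseteq> span B"
    using maximal_independent_subset_extend[of "{x}" S] x by auto
  have fin: "finite B" using B(3) by (rule finiteI_independent)
  have "f ` S \<subseteq> span (f ` B)"
    using B(4) linear_span_image[OF f] by blast
  also have "f ` B = insert 0 (f ` (B - {x}))"
    using B(1) x(3) by auto
  finally have "f ` S \<subseteq> span (f ` (B - {x}))" by simp
  then have "dim (f ` S) \<le> card (f ` (B - {x}))"
    using fin by (intro dim_le_card) auto
  also have "\<dots> \<le> card (B - {x})"
    using fin by (intro card_image_le) auto
  also have "\<dots> < card B"
    using B(1) fin by (intro psubset_card_mono) auto
  also have "card B = dim S"
    using B by (intro basis_card_eq_dim) auto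
  finally show "dim (f ` S) < dim S" .
qed

lemma tangent_conjugate_locus_iff:
  "X \<in> tangent_conjugate_locus \<longleftrightarrow>
    X \<in> skew_matrices \<and> (\<exists>H\<in>skew_matrices. H \<noteq> 0 \<and> exp_deriv [H] X = 0)"
  by (simp add: tangent_conjugate_locus_def frechet_derivative_matrix_exp
      dim_image_less_iff linear_exp_deriv subspace_skew_matrices)

lemma commute_matrix_exp_imp_commute:
  assumes "X \<in> skew_matrices - tangent_conjugate_locus" "Y \<in> skew_matrices"
    and "matrix_exp X ** Y = Y ** matrix_exp X"
  shows "X ** Y = Y ** X"
  using assms commutator_skew[of X Y] exp_deriv_commutator[of X Y]
  by (auto simp: tangent_conjugate_locus_iff)

section \<open>The spectral norm, extremal vectors and injectivity of the exponential\<close>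

lemma norm_matrix_vector_le: "norm (A *v x) \<le> spectral_norm A * norm x"
  unfolding spectral_norm_def by (rule onorm) (rule matrix_vector_mult.bounded_linear_right)

lemma spectral_norm_le:
  "(\<And>x. norm (A *v x) \<le> b * norm x) \<Longrightarrow> spectral_norm A \<le> b"
  unfolding spectral_norm_def by (rule onorm_le)

text \<open>Lets the triangle inequality, homogeneity and continuity be inherited from the norm on
  bounded linear maps.\<close>

lemma spectral_norm_eq_norm_Blinfun: "spectral_norm A = norm (Blinfun ((*v) A))"
  by (simp add: spectral_norm_def norm_blinfun.rep_eq bounded_linear_Blinfun_apply
      matrix_vector_mult.bounded_linear_right)

lemma Blinfun_matrix_vector_mult_diff:
  fixes A B :: "real^'n^'m"
  shows "Blinfun ((*v) (A - B)) = Blinfun ((*v) A) - Blinfun ((*v) B)"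
  by (rule blinfun_eqI) (simp add: bounded_linear_Blinfun_apply blinfun.diff_left
      matrix_vector_mult.bounded_linear_right matrix_vector_mult.diff_left)

lemma Blinfun_matrix_vector_mult_scaleR:
  fixes A :: "real^'n^'m"
  shows "Blinfun ((*v) (c *\<^sub>R A)) = c *\<^sub>R Blinfun ((*v) A)"
  by (rule blinfun_eqI) (simp add: bounded_linear_Blinfun_apply blinfun.scaleR_left
      matrix_vector_mult.bounded_linear_right matrix_vector_mult.scaleR_left)

lemma spectral_norm_minus_commute: "spectral_norm (A - B) = spectral_norm (B - A)"
  by (simp add: spectral_norm_eq_norm_Blinfun Blinfun_matrix_vector_mult_diff norm_minus_commute)

lemma spectral_norm_triangle: "spectral_norm (A - C) \<le> spectral_norm (A - B) + spectral_norm (B - C)"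
  using dist_triangle[of "Blinfun ((*v) A)" "Blinfun ((*v) C)" "Blinfun ((*v) B)"]
  by (simp add: spectral_norm_eq_norm_Blinfun Blinfun_matrix_vector_mult_diff dist_norm)

lemma spectral_norm_nonneg: "0 \<le> spectral_norm A"
  by (simp add: spectral_norm_eq_norm_Blinfun)

lemma spectral_norm_0 [simp]: "spectral_norm 0 = 0"
  by (simp add: spectral_norm_def matrix_vector_mult.zero_left onorm_zero)

lemma continuous_on_spectral_norm: "continuous_on UNIV (spectral_norm :: real^'n^'n \<Rightarrow> real)"
  unfolding spectral_norm_eq_norm_Blinfun[abs_def]
  by (intro continuous_on_norm continuous_on_blinfun_componentwise)
    (simp add: bounded_linear_Blinfun_apply matrix_vector_mult.bounded_linear_right
      linear_continuous_on matrix_vector_mult.bounded_linear_left)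

text \<open>Let \<open>x\<close> maximise the norm of \<open>A *v v\<close> over unit vectors of
  \<open>V\<close>, with maximum \<open>\<mu>\<close>. Then \<open>\<mu>\<^sup>2 + A\<^sup>2\<close>
  is symmetric and positive semidefinite on \<open>V\<close>, and its quadratic form vanishes at
  \<open>x\<close>, which forces \<open>x\<close> into its kernel.\<close>

lemma skew_extremal_vector:
  fixes A :: "real^'n^'n"
  assumes A: "A \<in> skew_matrices" and V: "subspace V" "V \<noteq> {0}" "\<And>v. v \<in> V \<Longrightarrow> A *v v \<in> V"
  obtains \<mu> x where "\<mu> \<ge> 0" "x \<in> V" "norm x = 1" "A *v (A *v x) = - (\<mu>\<^sup>2) *\<^sub>R x"
    "\<And>v. v \<in> V \<Longrightarrow> norm (A *v v) \<le> \<mu> * norm v"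
proof -
  let ?S = "V \<inter> sphere 0 1"
  have "compact ?S"
    by (intro closed_Int_compact closed_subspace V compact_sphere)
  moreover have "?S \<noteq> {}"
  proof -
    obtain v where "v \<in> V" "v \<noteq> 0" using V subspace_0 by blast
    then have "v /\<^sub>R norm v \<in> ?S" using V(1) by (simp add: subspace_scale)
    then show ?thesis by blast
  qed
  moreover have "continuous_on ?S (\<lambda>v. norm (A *v v))"
    by (intro continuous_intros linear_continuous_on matrix_vector_mult.bounded_linear_right)
  ultimately obtain x where x: "x \<in> ?S" "\<And>v. v \<in> ?S \<Longrightarrow> norm (A *v v) \<le> norm (A *v x)"
    using continuous_attains_sup[of ?S "\<lambda>v. norm (A *v v)"] by blast
  define \<mu> where "\<mu> = norm (A *v x)"
  have le: "norm (A *v v) \<le> \<mu> * norm v" if "v \<in> V" for v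
  proof (cases "v = 0")
    case False
    then have "v /\<^sub>R norm v \<in> ?S" using V(1) that by (simp add: subspace_scale)
    then have "norm (A *v (v /\<^sub>R norm v)) \<le> \<mu>" unfolding \<mu>_def by (rule x(2))
    then show ?thesis
      using False by (simp add: matrix_vector_mult.scaleR_right field_simps)
  qed (simp add: matrix_vector_mult.zero_right)
  define B where "B v = \<mu>\<^sup>2 *\<^sub>R v + A *v (A *v v)" for v
  have BV: "B v \<in> V" if "v \<in> V" for v
    using that V by (simp add: B_def subspace_add subspace_scale)
  have AA: "u \<bullet> (A *v (A *v v)) = - ((A *v u) \<bullet> (A *v v))" for u v
    using skew_inner[OF A, of u "A *v v"] by simp
  have psd: "v \<bullet> B v \<ge> 0" if "v \<in> V" for v
  proof -
    have "(norm (A *v v))\<^sup>2 \<le> (\<mu> * norm v)\<^sup>2"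
      using le[OF that] by (intro power_mono) auto
    then show ?thesis
      by (simp add: B_def inner_add_right AA power_mult_distrib dot_square_norm)
  qed
  have Bx0: "x \<bullet> B x = 0"
    using x(1) by (simp add: B_def inner_add_right AA dot_square_norm \<mu>_def)
  have "B x = 0"
  proof (rule ccontr)
    assume "B x \<noteq> 0"
    define z where "z = B x"
    define p where "p = z \<bullet> z"
    define c where "c = z \<bullet> B z"
    \<comment> \<open>Moving from \<open>x\<close> to \<open>x - e z\<close> changes the quadratic
      form from 0 to \<open>- 2 e p + e\<^sup>2 c\<close>. This \<open>e\<close> satisfies
      \<open>e c \<le> p\<close> and so makes the value negative; the added 1 keeps the denominator
      positive when \<open>c = 0\<close>.\<close>
    define e where "e = p / (c + 1)"
    have p: "p > 0" using \<open>B x \<noteq> 0\<close> by (simp add: p_def z_def)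
    have zV: "z \<in> V" using BV x(1) by (simp add: z_def)
    have c: "c \<ge> 0" using psd[OF zV] by (simp add: c_def)
    have e: "e > 0" using p c by (simp add: e_def)
    have "x - e *\<^sub>R z \<in> V" using x(1) zV V(1) by (simp add: subspace_diff subspace_scale)
    then have "0 \<le> (x - e *\<^sub>R z) \<bullet> B (x - e *\<^sub>R z)" by (rule psd)
    also have "B (x - e *\<^sub>R z) = z - e *\<^sub>R B z"
      by (simp add: z_def B_def matrix_vector_mult.diff_right matrix_vector_mult.add_right matrix_vector_mult.scaleR_right algebra_simps)
    also have "(x - e *\<^sub>R z) \<bullet> (z - e *\<^sub>R B z) = - e * (x \<bullet> B z) - e * p + e\<^sup>2 * c"
      using Bx0 by (simp add: z_def[symmetric] inner_diff_left inner_diff_right p_def c_def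
          power2_eq_square algebra_simps)
    also have "x \<bullet> B z = p"
    proof -
      have "x \<bullet> B z = B x \<bullet> z"
        unfolding B_def inner_add_left inner_add_right AA
        using skew_inner[OF A, of "A *v x" z] by simp
      then show ?thesis by (simp add: p_def z_def)
    qed
    finally have "2 * p \<le> e * c"
      using e by (simp add: power2_eq_square algebra_simps)
    also have "\<dots> \<le> p"
      using p c by (simp add: e_def field_simps)
    finally show False using p by simp
  qed
  then have "A *v (A *v x) = - (\<mu>\<^sup>2) *\<^sub>R x"
    by (simp add: B_def add_eq_0_iff)
  moreover have "\<mu> \<ge> 0" by (simp add: \<mu>_def)
  ultimately show thesis
    using x(1) le that[of \<mu> x] by auto
qed

text \<open>On the plane of an extremal vector \<open>x\<close> and \<open>Z *v x\<close>, the
  exponential rotates by \<open>\<mu>\<close>. It fixes \<open>x\<close>, so \<open>\<mu>\<close> is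
  a multiple of \<open>2 * pi\<close> that lies below \<open>2 * pi\<close>, hence zero; and
  \<open>\<mu>\<close> bounds \<open>Z\<close>.\<close>

lemma matrix_exp_eq_1_imp_0:
  fixes Z :: "real^'n^'n"
  assumes Z: "Z \<in> skew_matrices" "spectral_norm Z < 2 * pi" "matrix_exp Z = mat 1"
  shows "Z = 0"
proof -
  have "axis undefined 1 \<noteq> (0 :: real^'n)" by (simp add: axis_eq_0_iff)
  then have "UNIV \<noteq> {0 :: real^'n}" by blast
  then obtain \<mu> x where \<mu>: "\<mu> \<ge> 0" and x: "norm x = 1" "Z *v (Z *v x) = - (\<mu>\<^sup>2) *\<^sub>R x"
    and le: "\<And>v. norm (Z *v v) \<le> \<mu> * norm v"
    using skew_extremal_vector[OF Z(1) subspace_UNIV] by (metis UNIV_I)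
  have "\<mu> = 0"
  proof (rule ccontr)
    assume "\<mu> \<noteq> 0"
    with \<mu> have \<mu>0: "\<mu> > 0" by simp
    define y where "y = (Z *v x) /\<^sub>R \<mu>"
    have Zx: "Z *v x = \<mu> *\<^sub>R y" using \<mu>0 by (simp add: y_def)
    have Zy: "Z *v y = - \<mu> *\<^sub>R x"
      using \<mu>0 x(2) by (simp add: y_def matrix_vector_mult.scaleR_right power2_eq_square)
    have "x \<bullet> (Z *v x) = 0"
      using skew_inner[OF Z(1), of x x] by (simp add: inner_commute)
    then have "x \<bullet> y = 0" by (simp add: y_def)
    have "x = cos \<mu> *\<^sub>R x + sin \<mu> *\<^sub>R y"
      using matrix_exp_rotation[OF Zx Zy] Z(3) by simp
    then have "x \<bullet> x = cos \<mu> * (x \<bullet> x)"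
      using \<open>x \<bullet> y = 0\<close> by (metis add.right_neutral inner_add_right inner_scaleR_right mult_zero_right)
    then have "cos \<mu> = 1" using x(1) by (simp add: dot_square_norm)
    then obtain k :: int where k: "\<mu> = k * (2 * pi)"
      using cos_one_2pi_int by auto
    have "(norm (Z *v x))\<^sup>2 = - (x \<bullet> (Z *v (Z *v x)))"
      using skew_inner[OF Z(1), of x "Z *v x"] by (simp add: dot_square_norm)
    also have "\<dots> = \<mu>\<^sup>2" using x by (simp add: dot_square_norm)
    finally have "norm (Z *v x) = \<mu>" using \<mu> by (simp add: power2_eq_iff_nonneg)
    then have "\<mu> < 2 * pi"
      using norm_matrix_vector_le[of Z x] x(1) Z(2) by simp
    then have "real_of_int k < 1" using k by (simp add: field_simps)
    moreover have "real_of_int k > 0" using k \<mu>0 by (simp add: zero_less_mult_iff)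
    ultimately show False by simp
  qed
  then have "Z *v v = 0" for v using le[of v] by simp
  then show "Z = 0" unfolding matrix_eq by (simp add: matrix_vector_mult.zero_left)
qed

lemma matrix_exp_inject:
  assumes X: "X \<in> skew_matrices - tangent_conjugate_locus" and Y: "Y \<in> skew_matrices"
    and "spectral_norm (Y - X) < 2 * pi" "matrix_exp X = matrix_exp Y"
  shows "X = Y"
proof -
  have "matrix_exp X ** Y = Y ** matrix_exp X"
    using matrix_exp_commute[of Y Y] assms(4) by simp
  then have "X ** Y = Y ** X"
    using X Y by (rule commute_matrix_exp_imp_commute[rotated -1])
  then have "matrix_exp (Y - X) = mat 1"
    using matrix_exp_commuting_product[of X Y] matrix_exp_minus[of Y] assms(4) by simp
  moreover have "Y - X \<in> skew_matrices"
    using X Y by (simp add: subspace_diff subspace_skew_matrices)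
  ultimately show ?thesis
    using matrix_exp_eq_1_imp_0 assms(3) by fastforce
qed

section \<open>Smooth local inverses\<close>

definition skew_part :: "real^'n^'n \<Rightarrow> real^'n^'n" where
  "skew_part W = (1 / 2) *\<^sub>R (W - transpose W)"

definition sym_part :: "real^'n^'n \<Rightarrow> real^'n^'n" where
  "sym_part W = (1 / 2) *\<^sub>R (W + transpose W)"

lemma bounded_linear_skew_part: "bounded_linear skew_part"
  unfolding skew_part_def[abs_def]
  by (intro bounded_linear_intros bounded_linear_transpose)

lemma bounded_linear_sym_part: "bounded_linear sym_part"
  unfolding sym_part_def[abs_def]
  by (intro bounded_linear_intros bounded_linear_transpose)

lemmas transpose_linear_simps =
  linear_add[OF bounded_linear.linear[OF bounded_linear_transpose]]
  linear_diff[OF bounded_linear.linear[OF bounded_linear_transpose]]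
  linear_cmul[OF bounded_linear.linear[OF bounded_linear_transpose]]
  linear_neg[OF bounded_linear.linear[OF bounded_linear_transpose]]

lemma skew_part_skew: "skew_part W \<in> skew_matrices"
  unfolding skew_matrices_iff skew_part_def by (simp add: transpose_linear_simps flip: scaleR_minus_right)

lemma transpose_sym_part: "transpose (sym_part W) = sym_part W"
  unfolding sym_part_def by (simp add: transpose_linear_simps add.commute)

lemma skew_part_add_sym_part: "skew_part W + sym_part W = W"
proof -
  have "skew_part W + sym_part W = (1 / 2) *\<^sub>R (2 *\<^sub>R W)"
    unfolding skew_part_def sym_part_def scaleR_add_right[symmetric] scaleR_2 by simp
  then show ?thesis by simp
qed

lemma sym_part_of_skew: "X \<in> skew_matrices \<Longrightarrow> sym_part X = 0"
  by (simp add: sym_part_def skew_matrices_iff)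

lemma skew_part_of_skew: "X \<in> skew_matrices \<Longrightarrow> skew_part X = X"
  using skew_part_add_sym_part[of X] by (simp add: sym_part_of_skew)

lemma skew_and_symmetric_imp_0:
  assumes "K \<in> skew_matrices" "transpose K = K" shows "K = 0"
  using assms by (simp add: skew_matrices_iff eq_neg_iff_add_eq_0 flip: scaleR_2)

lemma transpose_exp_deriv: "transpose (exp_deriv [H] X) = exp_deriv [transpose H] (transpose X)"
proof -
  have "((\<lambda>W. transpose (matrix_exp W)) has_derivative (\<lambda>H. transpose (exp_deriv [H] X))) (at X)"
    by (rule bounded_linear.has_derivative[OF bounded_linear_transpose has_derivative_matrix_exp])
  moreover have "((\<lambda>W. matrix_exp (transpose W)) has_derivative
      (\<lambda>H. exp_deriv [transpose H] (transpose X))) (at X)"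
    by (rule has_derivative_compose[OF bounded_linear_imp_has_derivative[OF bounded_linear_transpose]
          has_derivative_matrix_exp])
  ultimately show ?thesis
    using has_derivative_unique unfolding transpose_matrix_exp by metis
qed

text \<open>Differentiating \<open>matrix_exp (- W) ** matrix_exp W = mat 1\<close> shows that the
  derivative takes values in the tangent space of the orthogonal group, translated here to the
  identity.\<close>

lemma exp_deriv_tangent:
  fixes X H :: "real^'n^'n"
  assumes X: "X \<in> skew_matrices" and H: "H \<in> skew_matrices"
  shows "transpose (matrix_exp X) ** exp_deriv [H] X \<in> skew_matrices"
proof -
  have "((\<lambda>W. matrix_exp (- W) ** matrix_exp W) has_derivative
      (\<lambda>H. matrix_exp (- X) ** exp_deriv [H] X + exp_deriv [- H] (- X) ** matrix_exp X)) (at X)"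
    by (intro matrix_mult.FDERIV has_derivative_matrix_exp has_derivative_compose[OF _ has_derivative_matrix_exp]
        has_derivative_minus has_derivative_ident)
  then have "((\<lambda>W. mat 1 :: real^'n^'n) has_derivative
      (\<lambda>H. matrix_exp (- X) ** exp_deriv [H] X + exp_deriv [- H] (- X) ** matrix_exp X)) (at X)"
    by (simp only: matrix_exp_minus')
  from has_derivative_unique[OF this has_derivative_const]
  have "matrix_exp (- X) ** exp_deriv [H] X + exp_deriv [- H] (- X) ** matrix_exp X = 0"
    by metis
  moreover have "exp_deriv [- H] (- X) = transpose (exp_deriv [H] X)"
    using X H by (simp add: transpose_exp_deriv skew_matrices_iff)
  ultimately show ?thesis
    by (simp add: skew_matrices_def matrix_transpose_mul flip: transpose_matrix_exp_skew[OF X])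
qed

text \<open>
  The inverse function theorem is applied to this map rather than to \<open>matrix_exp\<close>, whose derivative
  on the space of all matrices can be singular in symmetric directions outside the locus.
\<close>

definition tubular_exp :: "real^'n^'n \<Rightarrow> real^'n^'n" where
  "tubular_exp W = matrix_exp (skew_part W) ** (mat 1 + sym_part W)"

text \<open>The product rule for \<open>tubular_exp\<close> reduces to these two terms at
  skew-symmetric \<open>X\<close>. At other \<open>X\<close> it is only a formula continuous in
  \<open>X\<close>, which suffices for perturbation arguments.\<close>

definition tubular_deriv :: "real^'n^'n \<Rightarrow> real^'n^'n \<Rightarrow> real^'n^'n" where
  "tubular_deriv X H = matrix_exp X ** sym_part H + exp_deriv [skew_part H] X"

lemma tubular_exp_skew: "X \<in> skew_matrices \<Longrightarrow> tubular_exp X = matrix_exp X"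
  by (simp add: tubular_exp_def skew_part_of_skew sym_part_of_skew)

lemma Ck_on_tubular_exp: "Ck_on k UNIV (tubular_exp :: real^'n^'n \<Rightarrow> real^'n^'n)"
  unfolding tubular_exp_def[abs_def]
  by (intro Ck_on_bilinear[OF open_UNIV bounded_bilinear_matrix_mult]
      Ck_on_compose[OF open_UNIV open_UNIV _ Ck_on_matrix_exp] Ck_on_add Ck_on_const
      Ck_on_bounded_linear bounded_linear_skew_part bounded_linear_sym_part) auto

lemma has_derivative_tubular_exp:
  assumes "X \<in> skew_matrices"
  shows "(tubular_exp has_derivative tubular_deriv X) (at X)"
proof -
  have "(tubular_exp has_derivative (\<lambda>H. matrix_exp (skew_part X) ** (0 + sym_part H)
      + exp_deriv [skew_part H] (skew_part X) ** (mat 1 + sym_part X))) (at X)"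
    unfolding tubular_exp_def[abs_def]
    by (intro matrix_mult.FDERIV has_derivative_compose[OF _ has_derivative_matrix_exp]
        has_derivative_add has_derivative_const
        bounded_linear_imp_has_derivative bounded_linear_skew_part bounded_linear_sym_part)
  then show ?thesis
    using assms by (simp add: tubular_deriv_def[abs_def] skew_part_of_skew sym_part_of_skew)
qed

lemma linear_tubular_deriv: "linear (tubular_deriv X)"
  unfolding linear_iff tubular_deriv_def
  by (simp add: linear_add[OF linear_exp_deriv] linear_cmul[OF linear_exp_deriv]
      linear_add[OF bounded_linear.linear[OF bounded_linear_skew_part]]
      linear_cmul[OF bounded_linear.linear[OF bounded_linear_skew_part]]
      linear_add[OF bounded_linear.linear[OF bounded_linear_sym_part]]
      linear_cmul[OF bounded_linear.linear[OF bounded_linear_sym_part]]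
      matrix_mult.add_right matrix_mult.scaleR_right scaleR_add_right)

text \<open>After multiplication by the transpose of \<open>matrix_exp X\<close>, a kernel equation
  says that a symmetric and a skew-symmetric matrix add up to zero, so both vanish and only the
  kernel of the exponential on skew-symmetric directions remains.\<close>

lemma inj_tubular_deriv_iff:
  fixes X :: "real^'n^'n"
  assumes X: "X \<in> skew_matrices"
  shows "inj (tubular_deriv X) \<longleftrightarrow> X \<notin> tangent_conjugate_locus"
proof
  assume inj: "inj (tubular_deriv X)"
  have "H = 0" if "H \<in> skew_matrices" "exp_deriv [H] X = 0" for H
  proof -
    have "tubular_deriv X H = 0"
      using that by (simp add: tubular_deriv_def sym_part_of_skew skew_part_of_skew matrix_mult.zero_right)
    then show ?thesis
      using inj linear_injective_0[OF linear_tubular_deriv] by blast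
  qed
  then show "X \<notin> tangent_conjugate_locus"
    by (auto simp: tangent_conjugate_locus_iff)
next
  assume nl: "X \<notin> tangent_conjugate_locus"
  show "inj (tubular_deriv X)"
    unfolding linear_injective_0[OF linear_tubular_deriv]
  proof (intro allI impI)
    fix H assume 0: "tubular_deriv X H = 0"
    let ?T = "transpose (matrix_exp X)" and ?D = "exp_deriv [skew_part H] X"
    have T: "?T ** matrix_exp X = mat 1" "matrix_exp X ** ?T = mat 1"
      using X by (simp_all add: transpose_matrix_exp_skew matrix_exp_minus matrix_exp_minus')
    have "?T ** tubular_deriv X H = sym_part H + ?T ** ?D"
      by (simp add: tubular_deriv_def matrix_mult.add_right matrix_mul_assoc T)
    then have eq: "?T ** ?D = - sym_part H"
      using 0 by (simp add: matrix_mult.zero_right eq_neg_iff_add_eq_0 add.commute)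
    moreover have "?T ** ?D \<in> skew_matrices"
      by (intro exp_deriv_tangent X skew_part_skew)
    ultimately have "?T ** ?D = 0"
      by (intro skew_and_symmetric_imp_0) (simp_all add: transpose_linear_simps transpose_sym_part)
    with eq have "sym_part H = 0" by simp
    moreover have "?D = 0"
      using \<open>?T ** ?D = 0\<close> T(2) by (metis matrix_mul_assoc matrix_mul_lid matrix_mult.zero_right)
    then have "skew_part H = 0"
      using nl X skew_part_skew[of H] by (auto simp: tangent_conjugate_locus_iff)
    ultimately show "H = 0"
      using skew_part_add_sym_part[of H] by simp
  qed
qed

text \<open>Injectivity of \<open>tubular_deriv X\<close> comes with a lower bound that persists
  near \<open>X\<close>, and at skew-symmetric points injectivity means lying outside the
  locus.\<close>

lemma openin_nonconjugate:
  "openin (top_of_set skew_matrices) (skew_matrices - tangent_conjugate_locus :: (real^'n^'n) set)"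
  unfolding openin_euclidean_subtopology_iff
proof (intro conjI ballI)
  fix X :: "real^'n^'n" assume X: "X \<in> skew_matrices - tangent_conjugate_locus"
  have "((\<lambda>Y. tubular_deriv Y b) \<longlongrightarrow> tubular_deriv X b) (at X)" for b
  proof -
    have "isCont (\<lambda>Y. tubular_deriv Y b) X"
      unfolding tubular_deriv_def
      by (intro continuous_intros matrix_mult.isCont
          has_derivative_continuous[OF has_derivative_matrix_exp]
          has_derivative_continuous[OF has_derivative_exp_deriv])
    then show ?thesis by (simp add: isCont_def)
  qed
  then obtain c where c: "c > 0" "\<forall>\<^sub>F Y in at X. \<forall>H. c * norm H \<le> norm (tubular_deriv Y H)"
    using linear_family_bounded_below[of tubular_deriv X, OF linear_tubular_deriv
        always_eventually[OF allI[OF linear_tubular_deriv]]] X inj_tubular_deriv_iff[of X] by auto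
  from c(2) have "\<forall>\<^sub>F Y in at X. inj (tubular_deriv Y)"
  proof eventually_elim
    case (elim Y)
    show ?case
      unfolding linear_injective_0[OF linear_tubular_deriv]
      using elim c(1) by (metis mult_le_0_iff norm_le_zero_iff norm_zero not_less)
  qed
  then obtain d where d: "d > 0" "\<And>Y. Y \<noteq> X \<Longrightarrow> dist Y X < d \<Longrightarrow> inj (tubular_deriv Y)"
    unfolding eventually_at by blast
  show "\<exists>e>0. \<forall>Y\<in>skew_matrices. dist Y X < e \<longrightarrow> Y \<in> skew_matrices - tangent_conjugate_locus"
    using d X inj_tubular_deriv_iff by (metis DiffI)
qed auto

text \<open>A symmetric orthogonal \<open>1 + S\<close> squares to the identity, so
  \<open>S\<^sup>2 = - 2 S\<close>. A nonzero vector in the range of \<open>S\<close> would be an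
  eigenvector for the eigenvalue -2, which the norm bound excludes.\<close>

lemma symmetric_orthogonal_near_1:
  fixes S :: "real^'n^'n"
  assumes sym: "transpose S = S" and small: "spectral_norm S < 2"
    and orth: "transpose (mat 1 + S) ** (mat 1 + S) = mat 1"
  shows "S = 0"
proof -
  have "transpose (mat 1 + S) = mat 1 + S"
    by (simp add: transpose_linear_simps sym)
  with orth have "mat 1 + (S + (S + S ** S)) = mat 1"
    by (simp add: matrix_mult.add_left matrix_mult.add_right add.assoc)
  then have SS: "S ** S = - (S + S)"
    by (simp add: eq_neg_iff_add_eq_0 algebra_simps)
  have "S *v v = 0" for v
  proof (rule ccontr)
    let ?w = "S *v v"
    assume "?w \<noteq> 0"
    have "S *v ?w = - (2 *\<^sub>R ?w)"
      by (simp only: matrix_vector_mul_assoc SS matrix_vector_mult.minus_left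
          matrix_vector_mult.add_left scaleR_2)
    then have "2 * norm ?w \<le> spectral_norm S * norm ?w"
      using norm_matrix_vector_le[of S ?w] by simp
    then show False using small \<open>?w \<noteq> 0\<close> by simp
  qed
  then show ?thesis unfolding matrix_eq by (simp add: matrix_vector_mult.zero_left)
qed

lemma local_smooth_log:
  fixes X :: "real^'n^'n"
  assumes X: "X \<in> skew_matrices - tangent_conjugate_locus"
    and M: "openin (top_of_set skew_matrices) M" "X \<in> M"
  obtains V G where "open V" "matrix_exp X \<in> V" "\<And>k. Ck_on k V G"
    "\<And>Q. Q \<in> V \<inter> special_orthogonal \<Longrightarrow> G Q \<in> M \<and> matrix_exp (G Q) = Q"
proof -
  obtain N where N: "open N" "M = skew_matrices \<inter> N"
    using M(1) by (auto simp: openin_open)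
  have "inj (frechet_derivative tubular_exp (at X))"
    using X frechet_derivative_at[OF has_derivative_tubular_exp] inj_tubular_deriv_iff by (metis DiffE)
  then obtain U V G where UV: "open U" "open V" "X \<in> U" and hom: "homeomorphism U V tubular_exp G"
    and G: "\<And>k. Ck_on k V G"
    using smooth_inverse_function[OF Ck_on_tubular_exp] by blast
  \<comment> \<open>The first constraint places \<open>W\<close> in \<open>M\<close> once its
    symmetric part is known to vanish; the second is the smallness that makes it vanish for
    orthogonal values.\<close>
  define U' where "U' = U \<inter> (skew_part -` N \<inter> (\<lambda>W. spectral_norm (sym_part W)) -` {..<2})"
  have "open U'"
    unfolding U'_def
    by (intro open_Int UV open_vimage N linear_continuous_on bounded_linear_skew_part open_lessThan
        continuous_on_compose2[OF continuous_on_spectral_norm] bounded_linear_sym_part subset_UNIV)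
  define V' where "V' = V \<inter> G -` U'"
  have "open V'"
    unfolding V'_def using hom UV(2) \<open>open U'\<close>
    by (intro continuous_open_preimage) (auto simp: homeomorphism_def)
  have XU': "X \<in> U'"
    using X M(2) N(2) UV(3) by (simp add: U'_def skew_part_of_skew sym_part_of_skew)
  have GX: "G (matrix_exp X) = X" "matrix_exp X \<in> V"
    using hom UV(3) X tubular_exp_skew[of X] unfolding homeomorphism_def by force+
  show thesis
  proof (rule that[of V' G])
    show "open V'" by fact
    show "matrix_exp X \<in> V'" using GX XU' by (simp add: V'_def)
    show "Ck_on k V' G" for k
      using G by (rule Ck_on_subset[rotated]) (auto simp: V'_def)
    fix Q assume Q: "Q \<in> V' \<inter> special_orthogonal"
    define W where "W = G Q"
    define S where "S = sym_part W"
    let ?E = "matrix_exp (skew_part W)"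
    have W: "W \<in> U'" "?E ** (mat 1 + S) = Q"
      using Q hom by (auto simp: V'_def W_def S_def homeomorphism_def tubular_exp_def[symmetric])
    have "transpose ?E ** ?E = mat 1"
      using matrix_exp_special_orthogonal[OF skew_part_skew[of W]] by (simp add: special_orthogonal_def)
    moreover have "transpose (mat 1 + S) ** (transpose ?E ** ?E) ** (mat 1 + S) = transpose Q ** Q"
      by (simp only: W(2)[symmetric] matrix_transpose_mul matrix_mul_assoc)
    ultimately have "transpose (mat 1 + S) ** (mat 1 + S) = mat 1"
      using Q by (simp add: special_orthogonal_def)
    then have "S = 0"
      using W(1) by (intro symmetric_orthogonal_near_1) (auto simp: S_def transpose_sym_part U'_def)
    then have "skew_part W = W"
      using skew_part_add_sym_part[of W] by (simp add: S_def)
    then show "G Q \<in> M \<and> matrix_exp (G Q) = Q"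
      using W \<open>S = 0\<close> skew_part_skew[of W] N(2) by (auto simp: U'_def W_def)
  qed
qed

section \<open>Distance to the tangent conjugate locus\<close>

text \<open>An extremal vector \<open>x\<close> and the normalised \<open>A *v x\<close> span the
  plane when \<open>\<mu> > 0\<close>. When \<open>\<mu> = 0\<close>, \<open>A\<close> vanishes on
  \<open>V\<close> and any orthonormal pair serves, with angle 0.\<close>

lemma skew_invariant_plane:
  fixes A :: "real^'n^'n"
  assumes A: "A \<in> skew_matrices" and V: "subspace V" "\<And>v. v \<in> V \<Longrightarrow> A *v v \<in> V" and dim: "dim V \<ge> 2"
  obtains \<theta> x y where "\<theta> \<ge> 0" "x \<in> V" "y \<in> V" "norm x = 1" "norm y = 1" "x \<bullet> y = 0"
    "A *v x = \<theta> *\<^sub>R y" "A *v y = - \<theta> *\<^sub>R x"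
proof -
  have "V \<noteq> {0}" using dim by auto
  then obtain \<mu> x where \<mu>: "\<mu> \<ge> 0" and x: "x \<in> V" "norm x = 1" "A *v (A *v x) = - (\<mu>\<^sup>2) *\<^sub>R x"
    and le: "\<And>v. v \<in> V \<Longrightarrow> norm (A *v v) \<le> \<mu> * norm v"
    using skew_extremal_vector[OF A V(1) _ V(2)] by metis
  show thesis
  proof (cases "\<mu> = 0")
    case True
    let ?W = "{v \<in> V. \<forall>u\<in>span {x}. orthogonal u v}"
    have "dim ?W + dim (span {x}) = dim V"
      using V(1) x(1) by (intro dim_subspace_orthogonal_to_vectors span_minimal subspace_span) auto
    moreover have "dim (span {x}) \<le> 1"
      using dim_le_card[of "span {x}" "{x}"] by simp
    ultimately have "dim ?W \<noteq> 0" using dim by linarith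
    then obtain w where w: "w \<in> V" "w \<noteq> 0" "orthogonal x w"
      unfolding dim_eq_0 using span_base[of x "{x}"] by blast
    define y where "y = w /\<^sub>R norm w"
    have "y \<in> V" "norm y = 1" "x \<bullet> y = 0"
      using w V(1) by (simp_all add: y_def subspace_scale orthogonal_def)
    moreover have "A *v x = 0" "A *v y = 0"
      using le[OF x(1)] le[OF \<open>y \<in> V\<close>] True by auto
    ultimately show thesis using that[of 0 x y] x by simp
  next
    case False
    with \<mu> have \<mu>0: "\<mu> > 0" by simp
    define y where "y = (A *v x) /\<^sub>R \<mu>"
    have "(norm (A *v x))\<^sup>2 = - (x \<bullet> (A *v (A *v x)))"
      using skew_inner[OF A, of x "A *v x"] by (simp add: dot_square_norm)
    also have "\<dots> = \<mu>\<^sup>2" using x by (simp add: dot_square_norm)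
    finally have "norm (A *v x) = \<mu>" using \<mu> by (simp add: power2_eq_iff_nonneg)
    then have "norm y = 1" using \<mu>0 by (simp add: y_def)
    moreover have "x \<bullet> y = 0"
      using skew_inner[OF A, of x x] by (simp add: y_def inner_commute)
    moreover have "A *v x = \<mu> *\<^sub>R y" using \<mu>0 by (simp add: y_def)
    moreover have "A *v y = - \<mu> *\<^sub>R x"
      using \<mu>0 x(3) by (simp add: y_def matrix_vector_mult.scaleR_right power2_eq_square)
    moreover have "y \<in> V" using V x(1) by (simp add: y_def subspace_scale)
    ultimately show thesis using that[of \<mu> x y] \<mu> x by simp
  qed
qed

text \<open>This is \<open>y x^T - x y^T\<close>, for an orthonormal pair the infinitesimal rotation
  that sends \<open>x\<close> to \<open>y\<close> and \<open>y\<close> to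
  \<open>- x\<close>.\<close>

definition plane_generator :: "real^'n \<Rightarrow> real^'n \<Rightarrow> real^'n^'n" where
  "plane_generator x y = matrix (\<lambda>v. (x \<bullet> v) *\<^sub>R y - (y \<bullet> v) *\<^sub>R x)"

lemma plane_generator_mult: "plane_generator x y *v v = (x \<bullet> v) *\<^sub>R y - (y \<bullet> v) *\<^sub>R x"
  unfolding plane_generator_def
  by (rule fun_cong[OF matrix_vector_mul(2)]) (simp add: linear_iff inner_add_right algebra_simps)

lemma plane_generator_skew: "plane_generator x y \<in> skew_matrices"
  by (rule skew_matricesI)
    (simp add: plane_generator_mult inner_diff_left inner_diff_right inner_commute mult.commute)

lemma matrix_exp_on_plane:
  fixes B :: "real^'n^'n"
  assumes B: "B \<in> skew_matrices" and xy: "B *v x = \<phi> *\<^sub>R y" "B *v y = - \<phi> *\<^sub>R x"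
  shows "matrix_exp B *v x = cos \<phi> *\<^sub>R x + sin \<phi> *\<^sub>R y"
    and "matrix_exp B *v y = cos \<phi> *\<^sub>R y - sin \<phi> *\<^sub>R x"
    and "x \<bullet> (matrix_exp B *v v) = cos \<phi> * (x \<bullet> v) - sin \<phi> * (y \<bullet> v)"
    and "y \<bullet> (matrix_exp B *v v) = cos \<phi> * (y \<bullet> v) + sin \<phi> * (x \<bullet> v)"
proof -
  have rot: "matrix_exp C *v a = cos t *\<^sub>R a + sin t *\<^sub>R b" "matrix_exp C *v b = cos t *\<^sub>R b - sin t *\<^sub>R a"
    if "C *v a = t *\<^sub>R b" "C *v b = - t *\<^sub>R a" for C :: "real^'n^'n" and a b t
    using matrix_exp_rotation[OF that] matrix_exp_rotation[of C b t "- a"] that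
    by (simp_all add: matrix_vector_mult.minus_right)
  show "matrix_exp B *v x = cos \<phi> *\<^sub>R x + sin \<phi> *\<^sub>R y"
    "matrix_exp B *v y = cos \<phi> *\<^sub>R y - sin \<phi> *\<^sub>R x"
    by (rule rot[OF xy])+
  \<comment> \<open>Coordinates of \<open>matrix_exp B *v v\<close> for arbitrary \<open>v\<close>
    come from moving the exponential to the other side, where it becomes
    \<open>matrix_exp (- B)\<close> acting on the plane.\<close>
  have adj: "u \<bullet> (matrix_exp B *v v) = (matrix_exp (- B) *v u) \<bullet> v" for u
    by (simp only: inner_transpose_matrix[symmetric] transpose_matrix_exp_skew[OF B])
  have "matrix_exp (- B) *v x = cos \<phi> *\<^sub>R x - sin \<phi> *\<^sub>R y"
    "matrix_exp (- B) *v y = cos \<phi> *\<^sub>R y + sin \<phi> *\<^sub>R x"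
    using rot[of "- B" x "- \<phi>" y] xy by (simp_all add: matrix_vector_mult.minus_left)
  then show "x \<bullet> (matrix_exp B *v v) = cos \<phi> * (x \<bullet> v) - sin \<phi> * (y \<bullet> v)"
    "y \<bullet> (matrix_exp B *v v) = cos \<phi> * (y \<bullet> v) + sin \<phi> * (x \<bullet> v)"
    by (simp_all add: adj inner_diff_left inner_add_left)
qed

text \<open>
  If the angles of two planes add up to a multiple of \<open>2 * pi\<close>, then \<open>matrix_exp B\<close> rotates both by
  the same angle up to orientation, so it commutes with an infinitesimal rotation \<open>Y\<close> that mixes the
  planes, whereas \<open>B\<close> does not unless that multiple is zero.
\<close>

lemma tangent_conjugate_locusI:
  fixes B :: "real^'n^'n"
  assumes B: "B \<in> skew_matrices"
    and 1: "B *v x1 = \<phi>1 *\<^sub>R y1" "B *v y1 = - \<phi>1 *\<^sub>R x1"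
    and 2: "B *v x2 = \<phi>2 *\<^sub>R y2" "B *v y2 = - \<phi>2 *\<^sub>R x2"
    and norm: "norm x1 = 1" "norm y2 = 1"
    and orth: "x1 \<bullet> y1 = 0" "x1 \<bullet> x2 = 0" "x1 \<bullet> y2 = 0" "y1 \<bullet> x2 = 0" "y1 \<bullet> y2 = 0"
      "norm y1 = 1"
    and l: "\<phi>1 + \<phi>2 = 2 * pi * of_int l" "l \<noteq> 0"
  shows "B \<in> tangent_conjugate_locus"
proof -
  \<comment> \<open>\<open>Y\<close> sends \<open>x1\<close> to \<open>x2\<close> and
    \<open>y1\<close> to \<open>- y2\<close>. The sign reverses orientation because modulo
    \<open>2 * pi\<close> the second angle is the negative of the first.\<close>
  define Y where "Y = plane_generator x1 x2 - plane_generator y1 y2"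
  have Yv: "Y *v v = (x1 \<bullet> v) *\<^sub>R x2 - (x2 \<bullet> v) *\<^sub>R x1 - ((y1 \<bullet> v) *\<^sub>R y2 - (y2 \<bullet> v) *\<^sub>R y1)" for v
    by (simp add: Y_def matrix_vector_mult.diff_left plane_generator_mult)
  have Y: "Y \<in> skew_matrices"
    unfolding Y_def by (intro subspace_diff subspace_skew_matrices plane_generator_skew)
  have \<phi>2: "\<phi>2 = 2 * pi * of_int l - \<phi>1" using l(1) by (simp add: algebra_simps)
  have "cos \<phi>2 = cos \<phi>1" "sin \<phi>2 = - sin \<phi>1"
    unfolding \<phi>2 cos_diff sin_diff cos_int_2pin sin_int_2pin by simp_all
  note E = matrix_exp_on_plane[OF B 1] matrix_exp_on_plane[OF B 2, unfolded this]
  have "matrix_exp B *v (Y *v v) = Y *v (matrix_exp B *v v)" for v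
    unfolding Yv[of v] Yv[of "matrix_exp B *v v"] E
      matrix_vector_mult.diff_right matrix_vector_mult.scaleR_right
    by (simp add: algebra_simps)
  then have "matrix_exp B ** Y = Y ** matrix_exp B"
    by (simp add: matrix_eq flip: matrix_vector_mul_assoc)
  then have "exp_deriv [B ** Y - Y ** B] B = 0"
    using exp_deriv_commutator[of B Y] by simp
  moreover have "B ** Y - Y ** B \<noteq> 0"
  proof
    assume "B ** Y - Y ** B = 0"
    then have "(B ** Y - Y ** B) *v x1 = 0"
      by (simp add: matrix_vector_mult.zero_left)
    moreover have "(B ** Y - Y ** B) *v x1 = B *v (Y *v x1) - Y *v (B *v x1)"
      by (simp add: matrix_vector_mult.diff_left matrix_vector_mul_assoc)
    moreover have "Y *v x1 = x2"
      using norm orth by (simp add: Yv dot_square_norm inner_commute)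
    moreover have "Y *v y1 = - y2"
      using norm orth by (simp add: Yv dot_square_norm inner_commute)
    \<comment> \<open>The commutator maps \<open>x1\<close> to \<open>B x2 + \<phi>1 y2\<close>,
      which is \<open>(\<phi>1 + \<phi>2) y2\<close>.\<close>
    ultimately have "(\<phi>1 + \<phi>2) *\<^sub>R y2 = 0"
      using 1 2 by (simp add: matrix_vector_mult.scaleR_right scaleR_add_left add.commute)
    then show False using l norm(2) by auto
  qed
  ultimately show ?thesis
    using B commutator_skew[OF B Y] unfolding tangent_conjugate_locus_iff by blast
qed

text \<open>The rotations merely permute, up to sign, the coordinates of \<open>v\<close> along the
  four orthonormal vectors, so Bessel's inequality applies.\<close>

lemma spectral_norm_double_rotation_le:
  fixes x1 y1 x2 y2 :: "real^'n"
  assumes "norm x1 = 1" "norm y1 = 1" "norm x2 = 1" "norm y2 = 1"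
    and "x1 \<bullet> y1 = 0" "x1 \<bullet> x2 = 0" "x1 \<bullet> y2 = 0" "y1 \<bullet> x2 = 0" "y1 \<bullet> y2 = 0" "x2 \<bullet> y2 = 0"
  shows "spectral_norm (plane_generator x1 y1 + plane_generator x2 y2) \<le> 1"
proof (rule spectral_norm_le)
  fix v
  let ?J = "plane_generator x1 y1 + plane_generator x2 y2"
  have sym: "y1 \<bullet> x1 = 0" "x2 \<bullet> x1 = 0" "y2 \<bullet> x1 = 0" "x2 \<bullet> y1 = 0" "y2 \<bullet> y1 = 0" "y2 \<bullet> x2 = 0"
    using assms by (simp_all add: inner_commute)
  have nrm: "x1 \<bullet> x1 = 1" "y1 \<bullet> y1 = 1" "x2 \<bullet> x2 = 1" "y2 \<bullet> y2 = 1"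
    using assms by (simp_all add: dot_square_norm)
  define S where "S = (x1 \<bullet> v)\<^sup>2 + (y1 \<bullet> v)\<^sup>2 + (x2 \<bullet> v)\<^sup>2 + (y2 \<bullet> v)\<^sup>2"
  have "(norm (?J *v v))\<^sup>2 = S"
    unfolding dot_square_norm[symmetric] matrix_vector_mult.add_left plane_generator_mult S_def
    by (simp add: inner_add_left inner_add_right inner_diff_left inner_diff_right assms sym nrm
        power2_eq_square)
  define p where "p = (x1 \<bullet> v) *\<^sub>R x1 + (y1 \<bullet> v) *\<^sub>R y1 + (x2 \<bullet> v) *\<^sub>R x2 + (y2 \<bullet> v) *\<^sub>R y2"
  have "p \<bullet> p = S" "p \<bullet> v = S"
    unfolding p_def S_def
    by (simp_all add: inner_add_left inner_add_right assms sym nrm power2_eq_square)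
  then have "(v - p) \<bullet> (v - p) = v \<bullet> v - S"
    by (simp add: inner_diff_left inner_diff_right inner_commute)
  then have "S \<le> v \<bullet> v" using inner_ge_zero[of "v - p"] by simp
  then have "(norm (?J *v v))\<^sup>2 \<le> (norm v)\<^sup>2"
    using \<open>(norm (?J *v v))\<^sup>2 = S\<close> by (simp add: dot_square_norm)
  then have "norm (?J *v v) \<le> norm v" by (rule power2_le_imp_le) simp
  then show "norm (?J *v v) \<le> 1 * norm v" by simp
qed

lemma spectral_norm_scaleR: "spectral_norm (c *\<^sub>R A) = \<bar>c\<bar> * spectral_norm A"
  by (simp add: spectral_norm_eq_norm_Blinfun Blinfun_matrix_vector_mult_scaleR)

text \<open>Rounding \<open>s\<close> down to a multiple of \<open>2 * pi\<close> moves it by less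
  than \<open>2 * pi\<close>; below \<open>2 * pi\<close> it is raised to \<open>2 * pi\<close>
  instead, to avoid \<open>l = 0\<close>. The shift is split evenly between two angles.\<close>

lemma shift_to_multiple_of_2pi:
  fixes s :: real
  assumes "s \<ge> 0"
  obtains l :: int and \<delta> where "l \<noteq> 0" "\<bar>\<delta>\<bar> \<le> pi" "s + 2 * \<delta> = 2 * pi * of_int l"
proof -
  define l where "l = max 1 \<lfloor>s / (2 * pi)\<rfloor>"
  have "\<bar>2 * pi * of_int l - s\<bar> \<le> 2 * pi"
  proof (cases "s < 2 * pi")
    case True
    then have "s / (2 * pi) < 1" by (simp add: field_simps)
    then have "l = 1" unfolding l_def by (simp add: floor_less_iff max_def not_le)
    then show ?thesis using True assms by simp
  next
    case False
    then have "1 \<le> s / (2 * pi)" by (simp add: field_simps)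
    then have l: "l = \<lfloor>s / (2 * pi)\<rfloor>" unfolding l_def by (simp add: le_floor_iff max_def)
    have "of_int l \<le> s / (2 * pi)" "s / (2 * pi) < of_int l + 1"
      unfolding l by linarith+
    then have "2 * pi * of_int l \<le> s" "s < 2 * pi * of_int l + 2 * pi"
      by (simp_all add: field_simps)
    then show ?thesis by simp
  qed
  then have "\<bar>(2 * pi * of_int l - s) / 2\<bar> \<le> pi" by simp
  moreover have "l \<noteq> 0" by (simp add: l_def)
  ultimately show thesis
    using that[of l "(2 * pi * of_int l - s) / 2"] by (simp add: field_simps)
qed

lemma locus_dist_le_pi:
  fixes A :: "real^'n^'n"
  assumes A: "A \<in> skew_matrices" and card: "CARD('n) \<ge> 4"
  shows "locus_dist A \<le> ereal pi"
proof -
  obtain \<theta>1 x1 y1 where 1: "\<theta>1 \<ge> 0" "norm x1 = 1" "norm y1 = 1" "x1 \<bullet> y1 = 0"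
    "A *v x1 = \<theta>1 *\<^sub>R y1" "A *v y1 = - \<theta>1 *\<^sub>R x1"
    using skew_invariant_plane[OF A subspace_UNIV] card by auto
  define V where "V = {v. x1 \<bullet> v = 0 \<and> y1 \<bullet> v = 0}"
  have V: "subspace V"
    by (auto simp: V_def subspace_def inner_add_right)
  \<comment> \<open>The complement of an invariant plane is invariant by skew symmetry.\<close>
  have AV: "A *v v \<in> V" if "v \<in> V" for v
    using that skew_inner[OF A, of x1 v] skew_inner[OF A, of y1 v] 1 by (simp add: V_def)
  have "V = {v \<in> UNIV. \<forall>u\<in>span {x1, y1}. orthogonal u v}"
  proof (intro equalityI subsetI CollectI conjI ballI UNIV_I)
    fix v u assume "v \<in> V" "u \<in> span {x1, y1}"
    then show "orthogonal u v"
      using orthogonal_to_span[of u "{x1, y1}" v]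
      by (auto simp: V_def orthogonal_commute[of u v] orthogonal_def[of v] inner_commute[of v])
  next
    fix v assume "v \<in> {v \<in> UNIV. \<forall>u\<in>span {x1, y1}. orthogonal u v}"
    then show "v \<in> V"
      by (auto simp: V_def orthogonal_def span_base)
  qed
  then have "dim V + dim (span {x1, y1}) = dim (UNIV :: (real^'n) set)"
    by (simp only:) (intro dim_subspace_orthogonal_to_vectors, auto)
  moreover have "dim (span {x1, y1}) \<le> 2"
    using dim_le_card[of "span {x1, y1}" "{x1, y1}"] card_insert_le_m1[of 2 "{y1}" x1] by simp
  ultimately have "dim V \<ge> 2" using card by simp
  then obtain \<theta>2 x2 y2 where 2: "\<theta>2 \<ge> 0" "x2 \<in> V" "y2 \<in> V" "norm x2 = 1" "norm y2 = 1" "x2 \<bullet> y2 = 0"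
    "A *v x2 = \<theta>2 *\<^sub>R y2" "A *v y2 = - \<theta>2 *\<^sub>R x2"
    using skew_invariant_plane[OF A V AV] by metis
  have orth: "x1 \<bullet> x2 = 0" "x1 \<bullet> y2 = 0" "y1 \<bullet> x2 = 0" "y1 \<bullet> y2 = 0"
    using 2 by (auto simp: V_def)
  have orth': "x2 \<bullet> x1 = 0" "y2 \<bullet> x1 = 0" "x2 \<bullet> y1 = 0" "y2 \<bullet> y1 = 0" "y1 \<bullet> x1 = 0" "y2 \<bullet> x2 = 0"
    using orth 1(4) 2(6) by (simp_all add: inner_commute)
  have nrm: "x1 \<bullet> x1 = 1" "y1 \<bullet> y1 = 1" "x2 \<bullet> x2 = 1" "y2 \<bullet> y2 = 1"
    using 1 2 by (simp_all add: dot_square_norm)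
  obtain l :: int and \<delta> where l: "l \<noteq> 0" "\<bar>\<delta>\<bar> \<le> pi" "\<theta>1 + \<theta>2 + 2 * \<delta> = 2 * pi * of_int l"
    using shift_to_multiple_of_2pi[of "\<theta>1 + \<theta>2"] 1(1) 2(1) by auto
  \<comment> \<open>\<open>J\<close> rotates both planes at unit speed, so adding
    \<open>\<delta> *\<^sub>R J\<close> raises both angles by \<open>\<delta>\<close> and costs at
    most \<open>\<bar>\<delta>\<bar>\<close> in spectral norm.\<close>
  define J where "J = plane_generator x1 y1 + plane_generator x2 y2"
  define B where "B = A + \<delta> *\<^sub>R J"
  have Bv: "B *v v = A *v v + \<delta> *\<^sub>R ((x1 \<bullet> v) *\<^sub>R y1 - (y1 \<bullet> v) *\<^sub>R x1 + ((x2 \<bullet> v) *\<^sub>R y2 - (y2 \<bullet> v) *\<^sub>R x2))" for v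
    by (simp add: B_def J_def matrix_vector_mult.add_left matrix_vector_mult.scaleR_left plane_generator_mult)
  have B: "B \<in> skew_matrices"
    unfolding B_def J_def
    by (intro subspace_add subspace_scale subspace_skew_matrices plane_generator_skew A)
  have "B \<in> tangent_conjugate_locus"
  proof (rule tangent_conjugate_locusI[OF B])
    show "B *v x1 = (\<theta>1 + \<delta>) *\<^sub>R y1" "B *v y1 = - (\<theta>1 + \<delta>) *\<^sub>R x1"
      "B *v x2 = (\<theta>2 + \<delta>) *\<^sub>R y2" "B *v y2 = - (\<theta>2 + \<delta>) *\<^sub>R x2"
      using 1 2 orth orth' nrm by (simp_all add: Bv algebra_simps)
    show "\<theta>1 + \<delta> + (\<theta>2 + \<delta>) = 2 * pi * of_int l" using l by simp
  qed (use 1 2 orth l in auto)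
  moreover have "spectral_norm (A - B) \<le> pi"
  proof -
    have "spectral_norm (A - B) = \<bar>\<delta>\<bar> * spectral_norm J"
      using spectral_norm_scaleR[of "- \<delta>" J] by (simp add: B_def)
    also have "\<dots> \<le> \<bar>\<delta>\<bar> * 1"
      unfolding J_def by (intro mult_left_mono spectral_norm_double_rotation_le) (use 1 2 orth in auto)
    finally show ?thesis using l by simp
  qed
  ultimately show ?thesis
    unfolding locus_dist_def by (meson INF_lower2 ereal_less_eq(3))
qed

section \<open>Balls inside a connected component\<close>

lemma convex_skew_ball: "convex (skew_ball A \<delta>)"
proof (rule convexI)
  fix B C and u v :: real
  assume B: "B \<in> skew_ball A \<delta>" and C: "C \<in> skew_ball A \<delta>" and uv: "u \<ge> 0" "v \<ge> 0" "u + v = 1"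
  \<comment> \<open>The larger of the two norms is a real bound, whereas \<open>\<delta>\<close> may
    be infinite.\<close>
  let ?m = "max (spectral_norm (B - A)) (spectral_norm (C - A))"
  have "u *\<^sub>R B + v *\<^sub>R C - (u + v) *\<^sub>R A = u *\<^sub>R (B - A) + v *\<^sub>R (C - A)"
    by (simp add: scaleR_diff_right scaleR_add_left)
  then have eq: "u *\<^sub>R B + v *\<^sub>R C - A = u *\<^sub>R (B - A) + v *\<^sub>R (C - A)"
    by (simp only: uv(3) scaleR_one)
  have "spectral_norm (u *\<^sub>R B + v *\<^sub>R C - A) \<le> ?m"
  proof (rule spectral_norm_le)
    fix x
    have "norm ((u *\<^sub>R B + v *\<^sub>R C - A) *v x) \<le> u * norm ((B - A) *v x) + v * norm ((C - A) *v x)"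
      unfolding eq matrix_vector_mult.add_left matrix_vector_mult.scaleR_left
      using uv by (intro norm_triangle_le) simp
    also have "\<dots> \<le> u * (?m * norm x) + v * (?m * norm x)"
      using uv by (intro add_mono mult_left_mono order_trans[OF norm_matrix_vector_le] mult_right_mono) auto
    also have "\<dots> = ?m * norm x" using uv(3) by (simp flip: distrib_right)
    finally show "norm ((u *\<^sub>R B + v *\<^sub>R C - A) *v x) \<le> ?m * norm x" .
  qed
  then have "ereal (spectral_norm (u *\<^sub>R B + v *\<^sub>R C - A)) \<le> ereal ?m"
    by (simp only: ereal_less_eq)
  also have "ereal ?m < \<delta>" using B C by (simp add: skew_ball_def max_def)
  finally show "u *\<^sub>R B + v *\<^sub>R C \<in> skew_ball A \<delta>"
    using B C by (simp add: skew_ball_def subspace_add subspace_scale subspace_skew_matrices)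
qed

text \<open>A nonempty ball of this radius contains \<open>A\<close>, misses the locus and is
  connected by convexity, so maximality of the component applies.\<close>

lemma skew_ball_subset_component:
  assumes Se: "Se \<in> components (skew_matrices - tangent_conjugate_locus)" "A \<in> Se"
    and \<delta>: "\<delta> \<le> locus_dist A"
  shows "skew_ball A \<delta> \<subseteq> Se"
proof (cases "skew_ball A \<delta> = {}")
  case False
  then obtain B where B: "ereal (spectral_norm (B - A)) < \<delta>" by (auto simp: skew_ball_def)
  have "A \<in> skew_matrices - tangent_conjugate_locus"
    using Se in_components_subset by blast
  moreover have "0 < \<delta>"
    by (rule order_le_less_trans[OF _ B]) (simp add: spectral_norm_nonneg)
  ultimately have "A \<in> skew_ball A \<delta>" by (simp add: skew_ball_def zero_ereal_def)
  moreover have "skew_ball A \<delta> \<subseteq> skew_matrices - tangent_conjugate_locus"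
  proof
    fix C assume C: "C \<in> skew_ball A \<delta>"
    have "C \<notin> tangent_conjugate_locus"
    proof
      assume "C \<in> tangent_conjugate_locus"
      then have "locus_dist A \<le> ereal (spectral_norm (A - C))"
        unfolding locus_dist_def by (rule INF_lower)
      with C \<delta> show False
        unfolding skew_ball_def mem_Collect_eq spectral_norm_minus_commute[of A C]
        by (meson leD order_trans)
    qed
    then show "C \<in> skew_matrices - tangent_conjugate_locus"
      using C by (simp add: skew_ball_def)
  qed
  ultimately show ?thesis
    using components_maximal[OF Se(1) convex_connected[OF convex_skew_ball]] Se(2) by blast
qed simp

lemma openin_skew_ball: "openin (top_of_set skew_matrices) (skew_ball A (ereal r))"
proof -
  have "skew_ball A (ereal r) = skew_matrices \<inter> (\<lambda>B. spectral_norm (B - A)) -` {..<r}"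
    by (auto simp: skew_ball_def)
  moreover have "open ((\<lambda>B. spectral_norm (B - A)) -` {..<r})"
    by (intro open_vimage open_lessThan continuous_on_compose2[OF continuous_on_spectral_norm]
        continuous_intros subset_UNIV)
  ultimately show ?thesis by (auto simp: openin_open)
qed

text \<open>In dimension 2 the locus is empty and \<open>locus_dist A\<close> is infinite; in
  dimension 3 the origin has distance \<open>2 * pi\<close> from the locus. There the ball of radius
  \<open>locus_dist A\<close> can leave the ball of radius \<open>pi\<close>, hence the exclusion of
  these dimensions and the additional inclusion with the minimum. Openness of the image makes it a
  manifold on which \<open>smooth_map_on\<close> is the usual smoothness.\<close>

theorem theorem4p11:
  fixes A :: "real^'n^'n" and Se :: "(real^'n^'n) set"
  assumes "Se \<in> components (skew_matrices - tangent_conjugate_locus)"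
    and "A \<in> Se"
  shows "let M = Se \<inter> skew_ball A (ereal pi);
             Z = matrix_exp ` M
         in openin (top_of_set special_orthogonal) Z \<and>
            diffeomorphism M Z matrix_exp \<and>
            (CARD('n) \<notin> {2, 3} \<longrightarrow> skew_ball A (locus_dist A) \<subseteq> M) \<and>
            skew_ball A (min (locus_dist A) (ereal pi)) \<subseteq> M"
proof -
  define M where "M = Se \<inter> skew_ball A (ereal pi)"
  let ?Z = "matrix_exp ` M"
  have SeS: "Se \<subseteq> skew_matrices - tangent_conjugate_locus"
    using assms(1) by (rule in_components_subset)
  then have A: "A \<in> skew_matrices" and MS: "M \<subseteq> skew_matrices - tangent_conjugate_locus"
    using assms(2) by (auto simp: M_def)
  \<comment> \<open>Components of a relatively open subset of a locally connected space are
    relatively open.\<close>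
  have "locally connected (skew_matrices :: (real^'n^'n) set)"
    by (intro convex_imp_locally_connected subspace_imp_convex subspace_skew_matrices)
  then have "openin (top_of_set (skew_matrices - tangent_conjugate_locus)) Se"
    by (rule openin_components_locally_connected[OF locally_open_subset[OF _ openin_nonconjugate] assms(1)])
  then have openM: "openin (top_of_set skew_matrices) M"
    unfolding M_def
    by (rule openin_Int[OF openin_trans[OF _ openin_nonconjugate] openin_skew_ball])
  have inj: "inj_on matrix_exp M"
  proof (rule inj_onI)
    fix X Y assume X: "X \<in> M" and Y: "Y \<in> M" and eq: "matrix_exp X = matrix_exp Y"
    have "spectral_norm (X - A) < pi" "spectral_norm (Y - A) < pi"
      using X Y by (simp_all add: M_def skew_ball_def)
    then have "spectral_norm (Y - X) < 2 * pi"
      using spectral_norm_triangle[of Y X A] spectral_norm_minus_commute[of A X] by linarith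
    then show "X = Y"
      using matrix_exp_inject[OF subsetD[OF MS X] _ _ eq] subsetD[OF MS Y] by blast
  qed
  have log: "\<exists>V G. open V \<and> Q \<in> V \<and> (\<forall>k. Ck_on k V G)
      \<and> (\<forall>R\<in>V \<inter> special_orthogonal. G R \<in> M \<and> matrix_exp (G R) = R)" if Q: "Q \<in> ?Z" for Q
  proof -
    obtain X where X: "X \<in> M" "Q = matrix_exp X" using Q by blast
    show ?thesis
      by (rule local_smooth_log[OF subsetD[OF MS X(1)] openM X(1)], intro exI conjI)
        (use X(2) in auto)
  qed
  have ZSO: "?Z \<subseteq> special_orthogonal"
    using MS matrix_exp_special_orthogonal by auto
  have "openin (top_of_set special_orthogonal) ?Z"
  proof (subst openin_subopen, intro ballI)
    fix Q assume Q: "Q \<in> ?Z"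
    then obtain V G where V: "open V" "Q \<in> V"
      "\<And>R. R \<in> V \<inter> special_orthogonal \<Longrightarrow> G R \<in> M \<and> matrix_exp (G R) = R"
      using log by metis
    then have "special_orthogonal \<inter> V \<subseteq> ?Z" by (metis Int_commute imageI subsetI)
    then show "\<exists>T. openin (top_of_set special_orthogonal) T \<and> Q \<in> T \<and> T \<subseteq> ?Z"
      using V(1,2) Q ZSO by (intro exI[of _ "special_orthogonal \<inter> V"]) (auto simp: openin_open_Int)
  qed
  moreover have "diffeomorphism M ?Z matrix_exp"
    unfolding diffeomorphism_def
  proof (intro conjI)
    show "bij_betw matrix_exp M ?Z" using inj by (rule inj_on_imp_bij_betw)
    show "smooth_map_on M matrix_exp"
      unfolding smooth_map_on_def using Ck_on_matrix_exp open_UNIV by blast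
    show "smooth_map_on ?Z (inv_into M matrix_exp)"
      unfolding smooth_map_on_def
    proof
      fix Q assume "Q \<in> ?Z"
      then obtain V G where V: "open V" "Q \<in> V" "\<forall>k. Ck_on k V G"
        "\<And>R. R \<in> V \<inter> special_orthogonal \<Longrightarrow> G R \<in> M \<and> matrix_exp (G R) = R"
        using log by metis
      \<comment> \<open>\<open>G R\<close> lies in \<open>M\<close> and has exponential
        \<open>R\<close>, so injectivity identifies the local smooth inverse with the global
        one.\<close>
      have "G R = inv_into M matrix_exp R" if "R \<in> V \<inter> ?Z" for R
        using V(4)[of R] that ZSO inv_into_f_f[OF inj, of "G R"] by auto
      with V show "\<exists>U g. open U \<and> Q \<in> U \<and> (\<forall>k. Ck_on k U g)
          \<and> (\<forall>R\<in>U \<inter> ?Z. g R = inv_into M matrix_exp R)"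
        by blast
    qed
  qed
  moreover have minball: "skew_ball A (min (locus_dist A) (ereal pi)) \<subseteq> M"
    using skew_ball_subset_component[OF assms, of "min (locus_dist A) (ereal pi)"]
    by (auto simp: M_def skew_ball_def)
  moreover have "skew_ball A (locus_dist A) \<subseteq> M" if "CARD('n) \<notin> {2, 3}"
  proof (cases "CARD('n) \<ge> 4")
    case True
    then show ?thesis
      using locus_dist_le_pi[OF A] minball by (simp add: min_absorb1)
  next
    case False
    moreover have "CARD('n) > 0" by simp
    moreover have "CARD('n) \<noteq> 2" "CARD('n) \<noteq> 3" using that by auto
    ultimately have "CARD('n) = 1" by linarith
    then obtain a :: 'n where a: "UNIV = {a}" by (rule card_1_singletonE)
    \<comment> \<open>In dimension 1 the zero matrix is the only skew-symmetric one, so the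
      inclusion holds although \<open>locus_dist A\<close> is infinite.\<close>
    have eq0: "B = 0" if "B \<in> skew_matrices" for B :: "real^'n^'n"
    proof -
      have "B $ i $ j = 0" for i j
      proof -
        have "i = j" using a by (metis UNIV_I singletonD)
        moreover have "B $ i $ i + transpose B $ i $ i = 0"
          using that by (simp add: skew_matrices_def flip: vector_add_component)
        ultimately show ?thesis by (simp add: transpose_def)
      qed
      then show ?thesis by (simp add: vec_eq_iff)
    qed
    have "A \<in> M" using A assms(2) by (simp add: M_def skew_ball_def)
    then show ?thesis using eq0 A unfolding skew_ball_def by blast
  qed
  ultimately show ?thesis by (simp add: Let_def M_def)
qed

end
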